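(* Let $f\in C^3(\mathbb{R}^n;\mathbb{R}^n)$, let $\mathcal{T}$ be a triangulation in $\mathbb{R}^n$, let $\mu\ge0$, and let a feasible solution to Optimization Problem 1 (defined in the context) be given, with CPA interpolation $P$. Let $\widetilde m$ be an upper bound on the number of positive generalized eigenvalues of the matrix pairs $(A(x),P(x))$, and let $\mathcal{T}^*$ be a refined triangulation of $\mathcal{T}$. Consider a feasible solution to Optimization Problem 2 (defined in the context) for these data, and let $\mu(x)$ and $V(x)$, $x\in\mathcal{D}_{\mathcal{T}^*}$, be the CPA interpolations with respect to $\mathcal{T}^*$ of its vertex values $\mu(x_k)$ and $V(x_k)$. Then for every $x\in\mathcal{D}_{\mathcal{T}^*}^\circ$ we have $$A(x)-\mu(x)P(x)\preceq0\quad\text{and}\quad \dot V(x)+\widetilde m\,\mu(x)\le Q,$$ where $Q$ is the value of the variable $Q$ in the feasible solution to Optimization Problem 2.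
   Context: **Simplices and triangulations.** For affinely independent $x_0,\ldots,x_n\in\mathbb{R}^n$, the convex hull $\mathfrak{S}=\operatorname{co}(x_0,\ldots,x_n)$ is called a simplex; the convex hull of a nonempty proper subset of its vertices is called a face. A triangulation in $\mathbb{R}^n$ is a finite set $\mathcal{T}=\{\mathfrak{S}_\nu\}_\nu$ of ($n$-)simplices such that two different simplices of $\mathcal{T}$ intersect in a common face or not at all, and such that the interior $\mathcal{D}_{\mathcal{T}}^\circ$ of $\mathcal{D}_{\mathcal{T}}:=\bigcup_{\nu}\mathfrak{S}_\nu$ is connected. A refined triangulation $\mathcal{T}^*=\{\mathfrak{S}_\xi\}_\xi$ of $\mathcal{T}$ is a triangulation with $\mathcal{D}_{\mathcal{T}^*}=\mathcal{D}_{\mathcal{T}}$ such that each simplex $\mathfrak{S}_\nu\in\mathcal{T}$ is a union of simplices of $\mathcal{T}^*$. **CPA interpolation.** Given values at all vertices of the simplices of a triangulation, write $x\in\mathfrak{S}=\operatorname{co}(x_0,\ldots,x_n)$ uniquely as $x=\sum_{k=0}^n\lambda_kx_k$ with $\lambda_k\in[0,1]$, $\sum_k\lambda_k=1$, and put $g(x):=\sum_{k=0}^n\lambda_kg(x_k)$ (entrywise for matrices). For $P$ interpolated on $\mathcal{T}$, $w^\nu_{ij}\in\mathbb{R}^n$ denotes the constant gradient $\nabla P_{ij}|_{\mathfrak{S}_\nu}$; for $\mu(\cdot)$ and $V$ interpolated on $\mathcal{T}^*$, $\nabla\mu_\xi$ and $\nabla V_\xi$ denote their constant gradients on $\mathfrak{S}_\xi\in\mathcal{T}^*$.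 **Orbital derivatives and $A(x)$.** For $x\in\mathcal{D}_{\mathcal{T}^*}^\circ$ there exist $\mathfrak{S}_\xi\in\mathcal{T}^*$ and $\theta^*>0$ with $x+\theta f(x)\in\mathfrak{S}_\xi$ for all $\theta\in[0,\theta^*]$; let $\mathfrak{S}_\nu\in\mathcal{T}$ be the simplex with $\mathfrak{S}_\xi\subset\mathfrak{S}_\nu$. One puts $\dot V(x):=\nabla V_\xi\cdot f(x)$ and $$A(x):=P(x)\mathrm{D}f(x)+\mathrm{D}f(x)^\top P(x)+(w^\nu_{ij}\cdot f(x))_{i,j=1,\ldots,n}.$$ **Notation.** $I$ is the identity matrix; for symmetric matrices, $A\succeq B$ means $A-B$ is positive semidefinite. $\mathrm{D}f$ is the Jacobian matrix of $f=(f_1,\ldots,f_n)^\top$. For symmetric $A,B$ with $B$ positive definite, a generalized eigenvalue of $(A,B)$ is $\lambda\in\mathbb{R}$ with $Av=\lambda Bv$ for some $v\ne0$. **Optimization Problem 1** (for $f$, $\mathcal{T}$, $\mu\ge 0$). Constants: $\epsilon_0>0$; $h_\nu:=\operatorname{diam}(\mathfrak{S}_\nu)=\max_{x,y\in\mathfrak{S}_\nu}\|x-y\|_2$; numbers $B_\nu\ge\max_{x\in\mathfrak{S}_\nu,\ i,j,k}\left|\frac{\partial^2f_k(x)}{\partial x_i\partial x_j}\right|$ and $B_{3,\nu}\ge\max_{x\in\mathfrak{S}_\nu,\ i,j,k,l}\left|\frac{\partial^3f_l(x)}{\partial x_i\partial x_j\partial x_k}\right|$. Variables: a symmetric matrix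 $P(x_k)=(P_{ij}(x_k))\in\mathbb{R}^{n\times n}$ for each vertex $x_k$ of the simplices of $\mathcal{T}$, and numbers $C_\nu,D_\nu\ge0$ for each $\mathfrak{S}_\nu\in\mathcal{T}$. A feasible solution is a choice of the variables satisfying, for each $\mathfrak{S}_\nu=\operatorname{co}(x_0,\ldots,x_n)\in\mathcal{T}$ and each vertex $x_k$ of $\mathfrak{S}_\nu$: 1. $P(x_k)\succeq\epsilon_0I$; 2. $P(x_k)\preceq C_\nu I$; 3. $\|w^\nu_{ij}\|_1\le D_\nu$ for all $1\le i\le j\le n$; 4. $0\succeq A(x_k)-\mu P(x_k)+h_\nu^2E_\nu I$, where (for the simplex $\mathfrak{S}_\nu$ under consideration) $A(x_k):=P(x_k)\mathrm{D}f(x_k)+\mathrm{D}f(x_k)^\top P(x_k)+(w^\nu_{ij}\cdot f(x_k))_{i,j=1,\ldots,n}$ and $E_\nu:=n^2\left[(1+4\sqrt n)B_\nu D_\nu+2nB_{3,\nu}C_\nu\right]$. **Optimization Problem 2** (for a feasible solution of Optimization Problem 1, $\widetilde m$ and $\mathcal{T}^*$). Constants: $h_\xi:=\operatorname{diam}(\mathfrak{S}_\xi)$ (Euclidean norm) for $\mathfrak{S}_\xi\in\mathcal{T}^*$; $D_\nu,E_\nu$ from the feasible solution of Optimization Problem 1; numbers $B^*_\xi\ge\max_{x\in\mathfrak{S}_\xi,\ i,j,k}\left|\frac{\partial^2f_k(x)}{\partial x_i\partial x_j}\right|$. Variables: $\mu(x_k)\in\mathbb{R}$ and $V(x_k)\in\mathbb{R}$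 for each vertex $x_k$ of the simplices of $\mathcal{T}^*$; $D^\mu_\xi\ge0$ and $D^V_\xi\in\mathbb{R}$ for each $\mathfrak{S}_\xi\in\mathcal{T}^*$; $Q\ge0$. Objective: minimize $Q$. A feasible solution is a choice of the variables satisfying, for each $\mathfrak{S}_\xi=\operatorname{co}(x_0,\ldots,x_n)\in\mathcal{T}^*$ and each vertex $x_k$ of $\mathfrak{S}_\xi$, with $\mathfrak{S}_\nu\in\mathcal{T}$ the simplex such that $\mathfrak{S}_\xi\subset\mathfrak{S}_\nu$: 1. $\|\nabla\mu_\xi\|_\infty\le D^\mu_\xi$; 2. $A(x_k)-\mu(x_k)P(x_k)+h_\xi^2\left(E_\nu+2n\sqrt n\,D_\nu D^\mu_\xi\right)I\preceq0$, where $A(x_k):=P(x_k)\mathrm{D}f(x_k)+\mathrm{D}f(x_k)^\top P(x_k)+(w^\nu_{ij}\cdot f(x_k))_{i,j=1,\ldots,n}$ with this $\nu$; 3. $\|\nabla V_\xi\|_1\le D^V_\xi$; 4. $\nabla V_\xi\cdot f(x_k)+h_\xi^2\,nB^*_\xi D^V_\xi+\widetilde m\,\mu(x_k)\le Q$. *)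

theory Defs
  imports "HOL-Analysis.Analysis"
begin

section \<open>Smoothness and partial derivatives\<close>

definition partial_deriv :: "'n \<Rightarrow> (real^'n \<Rightarrow> 'b::real_normed_vector) \<Rightarrow> real^'n \<Rightarrow> 'b" where
  "partial_deriv i g x = frechet_derivative g (at x) (axis i 1)"

fun C_k :: "nat \<Rightarrow> (real^'n \<Rightarrow> 'b::real_normed_vector) \<Rightarrow> bool" where
  "C_k 0 g \<longleftrightarrow> continuous_on UNIV g"
| "C_k (Suc k) g \<longleftrightarrow> (\<forall>x. g differentiable (at x)) \<and> (\<forall>i. C_k k (partial_deriv i g))"

section \<open>Norms, Loewner order, generalized eigenvalues\<close>

text \<open>The Euclidean norm is the library's \<open>norm\<close>, the maximum norm is the library's \<open>infnorm\<close>,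
  and \<open>c I\<close> is the library's \<open>mat c\<close>.\<close>

definition norm_1 :: "real^'n \<Rightarrow> real" where
  "norm_1 x = (\<Sum>i\<in>UNIV. \<bar>x $ i\<bar>)"

definition symmetric_matrix :: "real^'n^'n \<Rightarrow> bool" where
  "symmetric_matrix M \<longleftrightarrow> transpose M = M"

definition psd :: "real^'n^'n \<Rightarrow> bool" where
  "psd M \<longleftrightarrow> symmetric_matrix M \<and> (\<forall>v. 0 \<le> v \<bullet> (M *v v))"

definition loewner_le :: "real^'n^'n \<Rightarrow> real^'n^'n \<Rightarrow> bool" (infix \<open>\<preceq>\<^sub>L\<close> 50) where
  "A \<preceq>\<^sub>L B \<longleftrightarrow> psd (B - A)"

definition gen_eigenvalue :: "real^'n^'n \<Rightarrow> real^'n^'n \<Rightarrow> real \<Rightarrow> bool" where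
  "gen_eigenvalue A B l \<longleftrightarrow> (\<exists>v. v \<noteq> 0 \<and> A *v v = l *\<^sub>R (B *v v))"

text \<open>Distinct values are counted (for positive definite \<open>B\<close> there are finitely many). Counting
  with multiplicity gives a number at least as large, so an upper bound for that number is also an
  upper bound for this one.\<close>

definition num_pos_gen_eigenvalues :: "real^'n^'n \<Rightarrow> real^'n^'n \<Rightarrow> nat" where
  "num_pos_gen_eigenvalues A B = card {l. l > 0 \<and> gen_eigenvalue A B l}"

section \<open>Simplices and triangulations\<close>

text \<open>A simplex is represented by its point set; its vertices are recovered from it, which is
  possible by \<open>simplex_vertices_convex_hull\<close>.\<close>

definition simplex_vertices :: "(real^'n) set \<Rightarrow> (real^'n) set" where
  "simplex_vertices S = (THE C. \<not> affine_dependent C \<and> S = convex hull C)"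

lemma simplex_vertices_convex_hull:
  fixes C :: "(real^'n) set"
  assumes "\<not> affine_dependent C"
  shows "simplex_vertices (convex hull C) = C"
  unfolding simplex_vertices_def
proof (rule the_equality)
  fix D :: "(real^'n) set" assume "\<not> affine_dependent D \<and> convex hull C = convex hull D"
  then show "D = C"
    using assms extreme_point_of_convex_hull_affine_independent
    by (metis subsetI subset_antisym)
qed (use assms in auto)

definition simplex_face :: "(real^'n) set \<Rightarrow> (real^'n) set \<Rightarrow> bool" where
  "simplex_face F S \<longleftrightarrow> (\<exists>C. C \<noteq> {} \<and> C \<subset> simplex_vertices S \<and> F = convex hull C)"

text \<open>The library's \<open>triangulation\<close> is a different notion: it allows simplices of every dimension
  and does not ask for connectedness.\<close>

definition is_triangulation :: "(real^'n) set set \<Rightarrow> bool" where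
  "is_triangulation \<T> \<longleftrightarrow>
     finite \<T> \<and>
     (\<forall>S\<in>\<T>. int CARD('n) simplex S) \<and>
     (\<forall>S\<in>\<T>. \<forall>S'\<in>\<T>. S \<noteq> S' \<longrightarrow>
        S \<inter> S' = {} \<or> (simplex_face (S \<inter> S') S \<and> simplex_face (S \<inter> S') S')) \<and>
     connected (interior (\<Union>\<T>))"

definition is_refinement :: "(real^'n) set set \<Rightarrow> (real^'n) set set \<Rightarrow> bool" where
  "is_refinement \<T>' \<T> \<longleftrightarrow>
     is_triangulation \<T>' \<and> \<Union>\<T>' = \<Union>\<T> \<and> (\<forall>S\<in>\<T>. \<exists>\<U>\<subseteq>\<T>'. S = \<Union>\<U>)"

text \<open>The unique simplex of \<open>\<T>\<close> containing a given simplex \<open>S\<close> of a refinement of \<open>\<T>\<close>.\<close>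

definition coarse_simplex :: "(real^'n) set set \<Rightarrow> (real^'n) set \<Rightarrow> (real^'n) set" where
  "coarse_simplex \<T> S = (THE S'. S' \<in> \<T> \<and> S \<subseteq> S')"

section \<open>CPA interpolation\<close>

definition barycentric :: "(real^'n) set \<Rightarrow> (real^'n \<Rightarrow> real) \<Rightarrow> real^'n \<Rightarrow> bool" where
  "barycentric S u x \<longleftrightarrow>
     (\<forall>v\<in>simplex_vertices S. 0 \<le> u v \<and> u v \<le> 1) \<and> (\<Sum>v\<in>simplex_vertices S. u v) = 1 \<and>
     x = (\<Sum>v\<in>simplex_vertices S. u v *\<^sub>R v)"

text \<open>Only the values of \<open>g\<close> at vertices matter. The value is independent of the choice of the
  simplex containing \<open>x\<close>, see \<open>cpa_eqI\<close>.\<close>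

definition cpa :: "(real^'n) set set \<Rightarrow> (real^'n \<Rightarrow> 'b::real_vector) \<Rightarrow> real^'n \<Rightarrow> 'b" where
  "cpa \<T> g x = (THE y. \<exists>S\<in>\<T>. \<exists>u. barycentric S u x \<and> y = (\<Sum>v\<in>simplex_vertices S. u v *\<^sub>R g v))"

lemma simplex_vertices_simplex:
  fixes S :: "(real^'n) set"
  assumes "m simplex S"
  shows "finite (simplex_vertices S)" "\<not> affine_dependent (simplex_vertices S)"
    "S = convex hull (simplex_vertices S)" "int (card (simplex_vertices S)) = m + 1"
proof -
  obtain C where C: "\<not> affine_dependent C" "int (card C) = m + 1" "S = convex hull C"
    using assms unfolding simplex_def by blast
  then have "simplex_vertices S = C" by (simp add: simplex_vertices_convex_hull)
  with C show "finite (simplex_vertices S)" "\<not> affine_dependent (simplex_vertices S)"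
    "S = convex hull (simplex_vertices S)" "int (card (simplex_vertices S)) = m + 1"
    by (auto simp: aff_independent_finite)
qed

lemma barycentric_unique:
  fixes S :: "(real^'n) set"
  assumes "m simplex S" "barycentric S u x" "barycentric S u' x" "v \<in> simplex_vertices S"
  shows "u v = u' v"
proof (rule ccontr)
  let ?V = "simplex_vertices S"
  assume "u v \<noteq> u' v"
  then have "\<exists>v\<in>?V. u v - u' v \<noteq> 0"
    using assms(4) by (intro bexI[of _ v]) simp_all
  moreover have "(\<Sum>w\<in>?V. u w - u' w) = 0"
    using assms(2,3) by (simp add: barycentric_def sum_subtractf)
  moreover have "(\<Sum>w\<in>?V. u w *\<^sub>R w) = x" "(\<Sum>w\<in>?V. u' w *\<^sub>R w) = x"
    using assms(2,3) by (simp_all only: barycentric_def)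
  then have "(\<Sum>w\<in>?V. (u w - u' w) *\<^sub>R w) = 0"
    by (simp add: sum_subtractf scaleR_diff_left)
  ultimately have "affine_dependent ?V"
    unfolding affine_dependent_explicit_finite[OF simplex_vertices_simplex(1)[OF assms(1)]]
    by (intro exI[of _ "\<lambda>w. u w - u' w"] conjI)
  then show False
    using simplex_vertices_simplex(2)[OF assms(1)] by contradiction
qed

lemma cpa_eqI:
  fixes \<T> :: "(real^'n) set set"
  assumes T: "is_triangulation \<T>" and S: "S \<in> \<T>" and u: "barycentric S u x"
  shows "cpa \<T> g x = (\<Sum>v\<in>simplex_vertices S. u v *\<^sub>R g v)"
proof -
  have simp: "int CARD('n) simplex R" if "R \<in> \<T>" for R
    using T that by (auto simp: is_triangulation_def)
  have eq: "(\<Sum>v\<in>simplex_vertices R. r v *\<^sub>R g v) = (\<Sum>v\<in>simplex_vertices S. u v *\<^sub>R g v)"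
    if R: "R \<in> \<T>" and r: "barycentric R r x" for R r
  proof (cases "R = S")
    case True
    then show ?thesis
      using barycentric_unique[OF simp[OF S], of r x u] r u by (intro sum.cong) simp_all
  next
    case False
    have mem: "x \<in> Q" if "Q \<in> \<T>" "barycentric Q q x" for Q q
    proof -
      let ?V = "simplex_vertices Q"
      have "x \<in> convex hull ?V"
        using that(2) simplex_vertices_simplex(1)[OF simp[OF that(1)]]
        by (auto simp: barycentric_def convex_hull_finite)
      then show ?thesis
        using simplex_vertices_simplex(3)[OF simp[OF that(1)]] by simp
    qed
    have "x \<in> R \<inter> S" using mem[OF R r] mem[OF S u] by auto
    then have "R \<inter> S \<noteq> {}" by blast
    then have "simplex_face (R \<inter> S) R \<and> simplex_face (R \<inter> S) S"
      using T R S False unfolding is_triangulation_def by metis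
    then obtain C C' where C: "C \<subset> simplex_vertices R" "R \<inter> S = convex hull C"
        "C' \<subset> simplex_vertices S" "R \<inter> S = convex hull C'"
      unfolding simplex_face_def by metis
    have "\<not> affine_dependent C"
      using affine_independent_subset[OF simplex_vertices_simplex(2)[OF simp[OF R]]] C(1) by simp
    moreover have "\<not> affine_dependent C'"
      using affine_independent_subset[OF simplex_vertices_simplex(2)[OF simp[OF S]]] C(3) by simp
    ultimately have "C = C'" using C(2,4) by (metis simplex_vertices_convex_hull)
    have fin: "finite (simplex_vertices R)" "finite (simplex_vertices S)"
      using simplex_vertices_simplex(1)[OF simp] R S by auto
    then have finC: "finite C" using C finite_subset by blast
    obtain w where w: "\<forall>v\<in>C. 0 \<le> w v" "sum w C = 1" "(\<Sum>v\<in>C. w v *\<^sub>R v) = x"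
      using \<open>x \<in> R \<inter> S\<close> finC unfolding C(2) by (auto simp: convex_hull_finite)
    have w1: "w v \<le> 1" if "v \<in> C" for v
      using member_le_sum[OF that, of w] w finC by auto
    define w' where "w' v = (if v \<in> C then w v else 0)" for v
    have ext: "(\<Sum>v\<in>V. w' v) = 1 \<and> (\<Sum>v\<in>V. w' v *\<^sub>R v) = x \<and>
        (\<Sum>v\<in>V. w' v *\<^sub>R g v) = (\<Sum>v\<in>C. w v *\<^sub>R g v)"
      if "C \<subseteq> V" "finite V" for V
      unfolding w(2)[symmetric] w(3)[symmetric] w'_def
      using that by (auto intro!: sum.mono_neutral_cong_right)
    note extR = ext[OF psubset_imp_subset[OF C(1)] fin(1)]
    note extS = ext[OF psubset_imp_subset[OF C(3), folded \<open>C = C'\<close>] fin(2)]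
    have w'01: "0 \<le> w' v \<and> w' v \<le> 1" for v
      using w(1) w1 by (simp add: w'_def)
    have bR: "barycentric R w' x" and bS: "barycentric S w' x"
      unfolding barycentric_def using extR extS w'01 by simp_all
    have "(\<Sum>v\<in>simplex_vertices R. r v *\<^sub>R g v) = (\<Sum>v\<in>simplex_vertices R. w' v *\<^sub>R g v)"
      using barycentric_unique[OF simp[OF R] r bR] by simp
    moreover have
      "(\<Sum>v\<in>simplex_vertices S. u v *\<^sub>R g v) = (\<Sum>v\<in>simplex_vertices S. w' v *\<^sub>R g v)"
      using barycentric_unique[OF simp[OF S] u bS] by simp
    ultimately show ?thesis using extR extS by simp
  qed
  show ?thesis
    unfolding cpa_def
  proof (rule the_equality)
    show "\<exists>R\<in>\<T>. \<exists>r. barycentric R r x \<and>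
        (\<Sum>v\<in>simplex_vertices S. u v *\<^sub>R g v) = (\<Sum>v\<in>simplex_vertices R. r v *\<^sub>R g v)"
      using S u by (intro bexI[of _ S] exI[of _ u]) simp_all
  next
    fix y assume "\<exists>R\<in>\<T>. \<exists>r. barycentric R r x \<and> y = (\<Sum>v\<in>simplex_vertices R. r v *\<^sub>R g v)"
    then obtain R r where "R \<in> \<T>" "barycentric R r x" "y = (\<Sum>v\<in>simplex_vertices R. r v *\<^sub>R g v)"
      by (elim bexE exE conjE)
    then show "y = (\<Sum>v\<in>simplex_vertices S. u v *\<^sub>R g v)"
      by (simp only: eq)
  qed
qed

definition simplex_gradient :: "(real^'n) set \<Rightarrow> (real^'n \<Rightarrow> real) \<Rightarrow> real^'n" where
  "simplex_gradient S g = (THE w. \<forall>x\<in>S. (g has_derivative (\<lambda>h. w \<bullet> h)) (at x within S))"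

lemma simplex_gradient_eqI:
  fixes S :: "(real^'n) set"
  assumes S: "int CARD('n) simplex S" and g: "\<And>x. x \<in> S \<Longrightarrow> g x = c + w \<bullet> x"
  shows "simplex_gradient S g = w"
  unfolding simplex_gradient_def
proof (rule the_equality)
  have lin: "((\<lambda>x. c + w \<bullet> x) has_derivative (\<lambda>h. w \<bullet> h)) (at x within S)" for x
    by (auto intro!: derivative_eq_intros)
  show "\<forall>x\<in>S. (g has_derivative (\<lambda>h. w \<bullet> h)) (at x within S)"
    using g lin by (auto intro: has_derivative_transform[of _ S g])
  fix w' assume w': "\<forall>x\<in>S. (g has_derivative (\<lambda>h. w' \<bullet> h)) (at x within S)"
  have "aff_dim S = int DIM(real^'n)"
    using aff_dim_simplex[OF S] by simp
  moreover have "S \<noteq> {}" using S by (auto simp: simplex_empty)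
  ultimately have "interior S \<noteq> {}"
    using convex_simplex[OF S] by (simp add: interior_rel_interior_gen rel_interior_eq_empty)
  then obtain x where x: "x \<in> interior S" by blast
  then have "x \<in> S" using interior_subset by blast
  moreover have "at x within S = at x" using x by (rule at_within_interior)
  ultimately have "(g has_derivative (\<lambda>h. w' \<bullet> h)) (at x)"
      "(g has_derivative (\<lambda>h. w \<bullet> h)) (at x)"
    using w' \<open>\<forall>x\<in>S. (g has_derivative (\<lambda>h. w \<bullet> h)) (at x within S)\<close> by metis+
  then have "(\<lambda>h. w' \<bullet> h) = (\<lambda>h. w \<bullet> h)" by (rule has_derivative_unique)
  then have "\<forall>z. w' \<bullet> z = w \<bullet> z" by (simp add: fun_eq_iff)
  then show "w' = w" by (simp only: vector_eq_rdot)
qed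

section \<open>The matrix A and orbital derivatives\<close>

text \<open>Below, \<open>P\<close>, \<open>V\<close> and \<open>\<mu>'\<close> denote vertex values, and \<open>cpa \<T> P\<close> etc. their interpolations.\<close>

definition grad_P :: "(real^'n) set set \<Rightarrow> (real^'n \<Rightarrow> real^'n^'n) \<Rightarrow> (real^'n) set \<Rightarrow> 'n \<Rightarrow> 'n \<Rightarrow> real^'n" where
  "grad_P \<T> P S i j = simplex_gradient S (\<lambda>x. cpa \<T> P x $ i $ j)"

definition A_on :: "(real^'n \<Rightarrow> real^'n) \<Rightarrow> (real^'n) set set \<Rightarrow> (real^'n \<Rightarrow> real^'n^'n)
    \<Rightarrow> (real^'n) set \<Rightarrow> real^'n \<Rightarrow> real^'n^'n" where
  "A_on f \<T> P S x =
     cpa \<T> P x ** jacobian f (at x) + transpose (jacobian f (at x)) ** cpa \<T> P x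
     + (\<chi> i j. grad_P \<T> P S i j \<bullet> f x)"

text \<open>If several simplices qualify, the values of \<open>A_at\<close> and \<open>V_dot\<close> do not depend on the choice,
  since \<open>w \<bullet> f x\<close> is then the one-sided directional derivative of the interpolation at \<open>x\<close>.\<close>

definition orbital_simplex :: "(real^'n \<Rightarrow> real^'n) \<Rightarrow> (real^'n) set set \<Rightarrow> real^'n \<Rightarrow> (real^'n) set" where
  "orbital_simplex f \<T>' x = (SOME S. S \<in> \<T>' \<and> (\<exists>b>0. \<forall>t\<in>{0..b}. x + t *\<^sub>R f x \<in> S))"

definition A_at :: "(real^'n \<Rightarrow> real^'n) \<Rightarrow> (real^'n) set set \<Rightarrow> (real^'n) set set
    \<Rightarrow> (real^'n \<Rightarrow> real^'n^'n) \<Rightarrow> real^'n \<Rightarrow> real^'n^'n" where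
  "A_at f \<T> \<T>' P x = A_on f \<T> P (coarse_simplex \<T> (orbital_simplex f \<T>' x)) x"

definition V_dot :: "(real^'n \<Rightarrow> real^'n) \<Rightarrow> (real^'n) set set \<Rightarrow> (real^'n \<Rightarrow> real) \<Rightarrow> real^'n \<Rightarrow> real" where
  "V_dot f \<T>' V x = simplex_gradient (orbital_simplex f \<T>' x) (cpa \<T>' V) \<bullet> f x"

section \<open>The optimization problems\<close>

definition bounds_second :: "(real^'n \<Rightarrow> real^'n) \<Rightarrow> (real^'n) set set \<Rightarrow> ((real^'n) set \<Rightarrow> real) \<Rightarrow> bool" where
  "bounds_second f \<T> B \<longleftrightarrow> (\<forall>S\<in>\<T>. \<forall>x\<in>S. \<forall>i j k.
     \<bar>partial_deriv i (partial_deriv j (\<lambda>y. f y $ k)) x\<bar> \<le> B S)"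

definition bounds_third :: "(real^'n \<Rightarrow> real^'n) \<Rightarrow> (real^'n) set set \<Rightarrow> ((real^'n) set \<Rightarrow> real) \<Rightarrow> bool" where
  "bounds_third f \<T> B3 \<longleftrightarrow> (\<forall>S\<in>\<T>. \<forall>x\<in>S. \<forall>i j k l.
     \<bar>partial_deriv i (partial_deriv j (partial_deriv k (\<lambda>y. f y $ l))) x\<bar> \<le> B3 S)"

definition E_const :: "((real^'n) set \<Rightarrow> real) \<Rightarrow> ((real^'n) set \<Rightarrow> real) \<Rightarrow> ((real^'n) set \<Rightarrow> real)
    \<Rightarrow> ((real^'n) set \<Rightarrow> real) \<Rightarrow> (real^'n) set \<Rightarrow> real" where
  "E_const B B3 C D S = (let n = real CARD('n) in
     n\<^sup>2 * ((1 + 4 * sqrt n) * B S * D S + 2 * n * B3 S * C S))"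

text \<open>The index type carries no order, so the gradient bound is imposed for all pairs \<open>(i, j)\<close>; by
  symmetry of \<open>P\<close> this is the same as imposing it for \<open>i \<le> j\<close>.\<close>

definition feasible_1 :: "(real^'n \<Rightarrow> real^'n) \<Rightarrow> (real^'n) set set \<Rightarrow> real
    \<Rightarrow> real \<Rightarrow> ((real^'n) set \<Rightarrow> real) \<Rightarrow> ((real^'n) set \<Rightarrow> real)
    \<Rightarrow> (real^'n \<Rightarrow> real^'n^'n) \<Rightarrow> ((real^'n) set \<Rightarrow> real) \<Rightarrow> ((real^'n) set \<Rightarrow> real) \<Rightarrow> bool" where
  "feasible_1 f \<T> \<mu> \<epsilon>\<^sub>0 B B3 P C D \<longleftrightarrow>
     (\<forall>S\<in>\<T>. C S \<ge> 0 \<and> D S \<ge> 0 \<and>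
        (\<forall>i j. norm_1 (grad_P \<T> P S i j) \<le> D S) \<and>
        (\<forall>v\<in>simplex_vertices S.
           symmetric_matrix (P v) \<and>
           mat \<epsilon>\<^sub>0 \<preceq>\<^sub>L P v \<and>
           P v \<preceq>\<^sub>L mat (C S) \<and>
           A_on f \<T> P S v - \<mu> *\<^sub>R P v + mat ((diameter S)\<^sup>2 * E_const B B3 C D S) \<preceq>\<^sub>L 0))"

definition feasible_2 :: "(real^'n \<Rightarrow> real^'n) \<Rightarrow> (real^'n) set set \<Rightarrow> (real^'n) set set \<Rightarrow> real
    \<Rightarrow> (real^'n \<Rightarrow> real^'n^'n) \<Rightarrow> ((real^'n) set \<Rightarrow> real) \<Rightarrow> ((real^'n) set \<Rightarrow> real)
    \<Rightarrow> ((real^'n) set \<Rightarrow> real) \<Rightarrow> (real^'n \<Rightarrow> real) \<Rightarrow> (real^'n \<Rightarrow> real)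
    \<Rightarrow> ((real^'n) set \<Rightarrow> real) \<Rightarrow> ((real^'n) set \<Rightarrow> real) \<Rightarrow> real \<Rightarrow> bool" where
  "feasible_2 f \<T> \<T>' m P D E B' \<mu>' V D\<^sub>\<mu> D\<^sub>V Q \<longleftrightarrow>
     Q \<ge> 0 \<and>
     (\<forall>S\<in>\<T>'. let n = real CARD('n); h = diameter S; N = coarse_simplex \<T> S in
        D\<^sub>\<mu> S \<ge> 0 \<and>
        infnorm (simplex_gradient S (cpa \<T>' \<mu>')) \<le> D\<^sub>\<mu> S \<and>
        norm_1 (simplex_gradient S (cpa \<T>' V)) \<le> D\<^sub>V S \<and>
        (\<forall>v\<in>simplex_vertices S.
           A_on f \<T> P N v - \<mu>' v *\<^sub>R cpa \<T> P v
             + mat (h\<^sup>2 * (E N + 2 * n * sqrt n * D N * D\<^sub>\<mu> S)) \<preceq>\<^sub>L 0 \<and>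
           simplex_gradient S (cpa \<T>' V) \<bullet> f v + h\<^sup>2 * n * B' S * D\<^sub>V S + m * \<mu>' v \<le> Q))"

end

theory Submission
  imports Defs
begin

text \<open>
  Fix an interior point \<open>x\<close>. It lies in a fine simplex \<open>S\<close> (the one entered in direction \<open>f x\<close>), and \<open>S\<close>
  lies in a single coarse simplex \<open>N\<close>. Hence all of \<open>P\<close>, \<open>\<mu>\<close> and \<open>V\<close> are affine on \<open>S\<close>, and the gradients
  occurring at \<open>x\<close> are the same as those in the constraints at the vertices \<open>x_k\<close> of \<open>S\<close>. With the
  barycentric coordinates \<open>\<lambda>_k\<close> of \<open>x\<close>, both claims compare a quantity at \<open>x\<close> with the mean, with
  weights \<open>\<lambda>_k\<close>, of its vertex values; the terms containing \<open>h_\<xi>^2\<close> in the constraints are a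
  margin for the difference.

  The difference is of order \<open>h_\<xi>^2\<close> for two reasons. Twice differentiable functions (components of \<open>f\<close>,
  and of its first derivatives) have a second-order interpolation error, since the linear terms of
  the expansion at \<open>x\<close> cancel in the mean (\<open>interpolation_error\<close>). In a product with an affine factor,
  namely \<open>P Df\<close> or \<open>\<mu> P\<close>, the remaining error is a covariance, a mean of products of two first-order
  deviations (\<open>product_interpolation_error\<close>). Adding these up for the entries of \<open>A\<close> gives
  \<open>A_on_interpolation_error\<close>. An entrywise error \<open>c\<close> changes a matrix by at most \<open>n c I\<close> in the Loewner
  order, which the margin absorbs (\<open>loewner_nonpos_from_vertices\<close>). For \<open>V\<close> the only error is that of \<open>f\<close>,
  tested against the constant gradient of \<open>V\<close> (\<open>inner_interpolation_error\<close>), because \<open>\<mu>\<close> is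
  reproduced exactly.
\<close>

section \<open>Norms and quadratic forms\<close>

lemma norm_1_le_norm:
  fixes y :: "real^'n"
  shows "norm_1 y \<le> sqrt (real CARD('n)) * norm y"
proof -
  have "(\<Sum>i\<in>UNIV. \<bar>y $ i\<bar> * \<bar>1\<bar>) \<le> L2_set (\<lambda>i. y $ i) UNIV * L2_set (\<lambda>i::'n. 1) UNIV"
    by (rule L2_set_mult_ineq)
  also have "L2_set (\<lambda>i. y $ i) UNIV = norm y"
    by (simp add: norm_vec_def L2_set_def)
  also have "L2_set (\<lambda>i::'n. 1::real) UNIV = sqrt (real CARD('n))"
    by (simp add: L2_set_def)
  finally show ?thesis
    by (simp add: norm_1_def mult.commute)
qed

lemma norm_1_nonneg: "0 \<le> norm_1 y"
  by (simp add: norm_1_def sum_nonneg)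

lemma norm_1_Holder: "\<bar>w \<bullet> y\<bar> \<le> norm_1 w * infnorm y"
proof -
  have "\<bar>w \<bullet> y\<bar> \<le> (\<Sum>i\<in>UNIV. \<bar>w $ i\<bar> * \<bar>y $ i\<bar>)"
    unfolding inner_vec_def by (rule order_trans[OF sum_abs]) (simp add: abs_mult)
  also have "\<dots> \<le> (\<Sum>i\<in>UNIV. \<bar>w $ i\<bar> * infnorm y)"
    by (intro sum_mono mult_left_mono component_le_infnorm_cart) simp
  finally show ?thesis
    by (simp add: norm_1_def sum_distrib_right)
qed

lemma abs_inner_le_norm_1:
  assumes "norm_1 w \<le> D" and "norm y \<le> h"
  shows "\<bar>w \<bullet> y\<bar> \<le> D * h"
proof -
  have "\<bar>w \<bullet> y\<bar> \<le> norm_1 w * infnorm y"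
    by (rule norm_1_Holder)
  also have "\<dots> \<le> D * h"
    using assms infnorm_le_norm[of y] infnorm_pos_le[of y] norm_1_nonneg[of w]
    by (intro mult_mono) auto
  finally show ?thesis .
qed

text \<open>All errors are estimated entry by entry; this bound, which for symmetric \<open>M\<close> amounts to
  \<open>norm_2 M \<le> n max |M_ij|\<close>, turns them into an error in the Loewner order.\<close>
lemma abs_quadratic_form_le:
  fixes M :: "real^'n^'n"
  assumes "\<And>i j. \<bar>M $ i $ j\<bar> \<le> c"
  shows "\<bar>v \<bullet> (M *v v)\<bar> \<le> real CARD('n) * c * (norm v)\<^sup>2"
proof -
  have c: "0 \<le> c"
    using assms[of undefined undefined] by linarith
  have "\<bar>v \<bullet> (M *v v)\<bar> \<le> (\<Sum>i\<in>UNIV. \<bar>v $ i\<bar> * \<bar>(M *v v) $ i\<bar>)"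
    unfolding inner_vec_def by (rule order_trans[OF sum_abs]) (simp add: abs_mult)
  also have "\<dots> \<le> (\<Sum>i\<in>UNIV. \<bar>v $ i\<bar> * (c * norm_1 v))"
  proof (intro sum_mono mult_left_mono)
    fix i
    have "\<bar>(M *v v) $ i\<bar> \<le> (\<Sum>j\<in>UNIV. \<bar>M $ i $ j\<bar> * \<bar>v $ j\<bar>)"
      unfolding matrix_vector_mult_def by (simp, rule order_trans[OF sum_abs]) (simp add: abs_mult)
    also have "\<dots> \<le> (\<Sum>j\<in>UNIV. c * \<bar>v $ j\<bar>)"
      by (intro sum_mono mult_right_mono assms) simp
    finally show "\<bar>(M *v v) $ i\<bar> \<le> c * norm_1 v"
      by (simp add: norm_1_def sum_distrib_left)
  qed simp
  also have "\<dots> = c * (norm_1 v)\<^sup>2"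
    by (simp add: norm_1_def sum_distrib_right[symmetric] power2_eq_square)
  also have "\<dots> \<le> c * (sqrt (real CARD('n)) * norm v)\<^sup>2"
    by (intro mult_left_mono power_mono norm_1_le_norm norm_1_nonneg c)
  finally show ?thesis
    by (simp add: power_mult_distrib mult_ac)
qed

lemma symmetric_matrix_iff: "symmetric_matrix M \<longleftrightarrow> (\<forall>i j. M $ i $ j = M $ j $ i)"
  unfolding symmetric_matrix_def transpose_def vec_eq_iff vec_lambda_beta by blast

lemma quadratic_form_mat: "v \<bullet> (mat c *v v) = c * (norm v)\<^sup>2"
proof -
  have "mat c *v v = c *\<^sub>R v"
    by (simp add: mat_def matrix_vector_mult_def vec_eq_iff if_distrib[of "\<lambda>a. a * _"] cong: if_cong)
  then show ?thesis
    by (simp add: power2_norm_eq_inner)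
qed

lemma quadratic_form_entries: "v \<bullet> (M *v v) = (\<Sum>i\<in>UNIV. \<Sum>j\<in>UNIV. v $ i * v $ j * M $ i $ j)"
  by (simp add: inner_vec_def matrix_vector_mult_def sum_distrib_left mult_ac)

lemma loewner_le_quadratic_form:
  assumes "X \<preceq>\<^sub>L Y"
  shows "v \<bullet> (X *v v) \<le> v \<bullet> (Y *v v)"
  using assms unfolding loewner_le_def psd_def
  by (auto simp: matrix_vector_mult_diff_rdistrib inner_diff_right)

text \<open>By polarization \<open>4 M_ij\<close> is the difference of the values of the quadratic form at
  \<open>e_i + e_j\<close> and \<open>e_i - e_j\<close>; both values lie in \<open>[0, 4c]\<close>, also when \<open>i = j\<close>.\<close>
lemma entry_le_loewner_bound:
  fixes M :: "real^'n^'n"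
  assumes sym: "symmetric_matrix M" and "mat 0 \<preceq>\<^sub>L M" and "M \<preceq>\<^sub>L mat c"
  shows "\<bar>M $ i $ j\<bar> \<le> c"
proof -
  let ?q = "\<lambda>v. v \<bullet> (M *v v)"
  let ?e = "\<lambda>i::'n. axis i (1::real)"
  have bounds: "0 \<le> ?q v" "?q v \<le> c * (norm v)\<^sup>2" for v
    using loewner_le_quadratic_form[OF assms(2), of v] loewner_le_quadratic_form[OF assms(3), of v]
    by (simp_all add: quadratic_form_mat)
  have c: "0 \<le> c"
    using bounds[of "?e i"] by simp
  have entry: "?e a \<bullet> (M *v ?e b) = M $ a $ b" for a b
    by (simp add: inner_axis' matrix_vector_mult_basis column_def)
  have "4 * (M $ i $ j) = ?q (?e i + ?e j) - ?q (?e i - ?e j)"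
    using sym unfolding symmetric_matrix_iff
    by (simp add: matrix_vector_right_distrib matrix_vector_mult_diff_distrib inner_add_left inner_diff_left
        inner_add_right inner_diff_right entry)
  moreover have "?q (?e i + ?e j) \<le> c * 4" "?q (?e i - ?e j) \<le> c * 4"
  proof -
    have "norm (?e i + ?e j) \<le> 2" "norm (?e i - ?e j) \<le> 2"
      using norm_triangle_ineq[of "?e i" "?e j"] norm_triangle_ineq4[of "?e i" "?e j"] by simp_all
    then have "(norm (?e i + ?e j))\<^sup>2 \<le> 2\<^sup>2" "(norm (?e i - ?e j))\<^sup>2 \<le> 2\<^sup>2"
      by (intro power_mono; simp)+
    then have "c * (norm (?e i + ?e j))\<^sup>2 \<le> c * 4" "c * (norm (?e i - ?e j))\<^sup>2 \<le> c * 4"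
      using c by (intro mult_left_mono; simp)+
    then show "?q (?e i + ?e j) \<le> c * 4" "?q (?e i - ?e j) \<le> c * 4"
      using bounds(2) order_trans by blast+
  qed
  ultimately show ?thesis
    using bounds(1)[of "?e i + ?e j"] bounds(1)[of "?e i - ?e j"] by linarith
qed

text \<open>The mechanism by which conditions at vertices become conditions at interior points: the convex
  combination of the vertex matrices is at most \<open>-d I\<close>, and the margin \<open>d\<close> absorbs the deviation of
  \<open>M\<close> from that combination.\<close>
lemma loewner_nonpos_from_vertices:
  fixes M :: "real^'n^'n" and N :: "'a \<Rightarrow> real^'n^'n"
  assumes sym: "symmetric_matrix M"
    and u: "\<And>k. k \<in> K \<Longrightarrow> 0 \<le> u k" "sum u K = 1"
    and N: "\<And>k. k \<in> K \<Longrightarrow> N k + mat d \<preceq>\<^sub>L 0"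
    and err: "\<And>i j. \<bar>M $ i $ j - (\<Sum>k\<in>K. u k * N k $ i $ j)\<bar> \<le> c"
    and "real CARD('n) * c \<le> d"
  shows "M \<preceq>\<^sub>L 0"
proof -
  have "v \<bullet> (M *v v) \<le> 0" for v
  proof -
    let ?R = "M - (\<Sum>k\<in>K. u k *\<^sub>R N k)"
    have sumN: "v \<bullet> ((\<Sum>k\<in>K. u k *\<^sub>R N k) *v v) = (\<Sum>k\<in>K. u k * (v \<bullet> (N k *v v)))"
    proof -
      have "v \<bullet> ((\<Sum>k\<in>K. u k *\<^sub>R N k) *v v)
          = (\<Sum>i\<in>UNIV. \<Sum>j\<in>UNIV. \<Sum>k\<in>K. u k * (v $ i * v $ j * N k $ i $ j))"
        by (simp add: quadratic_form_entries sum_distrib_left mult_ac)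
      also have "\<dots> = (\<Sum>i\<in>UNIV. \<Sum>k\<in>K. \<Sum>j\<in>UNIV. u k * (v $ i * v $ j * N k $ i $ j))"
        by (intro sum.cong refl sum.swap)
      also have "\<dots> = (\<Sum>k\<in>K. \<Sum>i\<in>UNIV. \<Sum>j\<in>UNIV. u k * (v $ i * v $ j * N k $ i $ j))"
        by (rule sum.swap)
      finally show ?thesis
        by (simp add: quadratic_form_entries sum_distrib_left)
    qed
    have "v \<bullet> (?R *v v) \<le> real CARD('n) * c * (norm v)\<^sup>2"
      using abs_quadratic_form_le[of ?R c v] err by (auto simp: abs_le_iff)
    also have "\<dots> \<le> d * (norm v)\<^sup>2"
      by (intro mult_right_mono assms) simp
    finally have R: "v \<bullet> (?R *v v) \<le> d * (norm v)\<^sup>2" .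
    have "(\<Sum>k\<in>K. u k * (v \<bullet> (N k *v v))) \<le> (\<Sum>k\<in>K. u k * (- d * (norm v)\<^sup>2))"
    proof (intro sum_mono mult_left_mono u)
      fix k assume "k \<in> K"
      from loewner_le_quadratic_form[OF N[OF this], of v]
      show "v \<bullet> (N k *v v) \<le> - d * (norm v)\<^sup>2"
        by (simp add: matrix_vector_mult_add_rdistrib inner_add_right quadratic_form_mat)
    qed
    also have "\<dots> = - d * (norm v)\<^sup>2"
      unfolding sum_distrib_right[symmetric] u(2) by simp
    finally show ?thesis
      using R sumN by (simp add: matrix_vector_mult_diff_rdistrib inner_diff_right)
  qed
  moreover have "symmetric_matrix (0 - M)"
    using sym by (simp add: symmetric_matrix_iff)
  moreover have "v \<bullet> ((0 - M) *v v) = - (v \<bullet> (M *v v))" for v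
    by (simp add: quadratic_form_entries sum_negf)
  ultimately show ?thesis
    unfolding loewner_le_def psd_def by simp
qed

section \<open>Partial derivatives and first-order remainders\<close>

lemma partial_deriv_component:
  fixes f :: "real^'n \<Rightarrow> real^'m"
  assumes "f differentiable (at x)"
  shows "partial_deriv j (\<lambda>y. f y $ k) x = partial_deriv j f x $ k"
proof -
  have "(f has_derivative frechet_derivative f (at x)) (at x)"
    using assms by (simp add: frechet_derivative_works)
  then have "((\<lambda>y. f y $ k) has_derivative (\<lambda>h. frechet_derivative f (at x) h $ k)) (at x)"
    by (rule bounded_linear.has_derivative[OF bounded_linear_vec_nth])
  then have "frechet_derivative (\<lambda>y. f y $ k) (at x) = (\<lambda>h. frechet_derivative f (at x) h $ k)"
    by (rule frechet_derivative_at[symmetric])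
  then show ?thesis
    by (simp add: partial_deriv_def)
qed

lemma C_k_component:
  fixes f :: "real^'n \<Rightarrow> real^'m"
  assumes "C_k r f"
  shows "C_k r (\<lambda>x. f x $ k)"
  using assms
proof (induction r arbitrary: f)
  case 0
  then show ?case
    by (auto intro!: continuous_intros)
next
  case (Suc r)
  have "(\<lambda>x. f x $ k) differentiable (at x)" for x
  proof -
    have "f differentiable (at x)"
      using Suc.prems by simp
    then show ?thesis
      unfolding differentiable_def using bounded_linear.has_derivative[OF bounded_linear_vec_nth] by blast
  qed
  moreover have "partial_deriv i (\<lambda>x. f x $ k) = (\<lambda>x. partial_deriv i f x $ k)" for i
    using Suc.prems by (auto simp: partial_deriv_component)
  ultimately show ?case
    using Suc by simp
qed

lemma C_k_SucD: "C_k (Suc r) g \<Longrightarrow> C_k r g"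
proof (induction r arbitrary: g)
  case 0
  then show ?case
    by (auto intro!: continuous_at_imp_continuous_on differentiable_imp_continuous_within)
next
  case (Suc r)
  then show ?case
    by (metis C_k.simps(2))
qed

lemma jacobian_entry:
  fixes f :: "real^'n \<Rightarrow> real^'m"
  assumes "f differentiable (at x)"
  shows "jacobian f (at x) $ k $ j = partial_deriv j (\<lambda>y. f y $ k) x"
  unfolding partial_deriv_component[OF assms] by (simp add: jacobian_def matrix_def partial_deriv_def)

lemma frechet_derivative_partial_sum:
  fixes g :: "real^'n \<Rightarrow> real"
  assumes "g differentiable (at x)"
  shows "frechet_derivative g (at x) h = (\<Sum>i\<in>UNIV. h $ i * partial_deriv i g x)"
proof -
  let ?G = "frechet_derivative g (at x)"
  have lin: "linear ?G"
    using assms frechet_derivative_works has_derivative_linear by blast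
  have "?G h = ?G (\<Sum>i\<in>UNIV. h $ i *\<^sub>R axis i 1)"
    using basis_expansion[of h] by (simp add: scalar_mult_eq_scaleR)
  also have "\<dots> = (\<Sum>i\<in>UNIV. h $ i * ?G (axis i 1))"
    using lin by (simp add: linear_sum linear_cmul)
  finally show ?thesis
    by (simp add: partial_deriv_def)
qed

lemma mean_value_partial_derivs:
  fixes g :: "real^'n \<Rightarrow> real"
  assumes "\<And>z. g differentiable (at z)"
  obtains z where "z \<in> closed_segment x y"
    and "g y - g x = (\<Sum>i\<in>UNIV. (y - x) $ i * partial_deriv i g z)"
proof -
  let ?p = "\<lambda>t. x + t *\<^sub>R (y - x)"
  have "(g has_derivative frechet_derivative g (at z)) (at z within T)" for z T
    using assms by (simp add: frechet_derivative_works[symmetric] has_derivative_at_withinI)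
  moreover have "(?p has_derivative (\<lambda>s. s *\<^sub>R (y - x))) (at t within T)" for t T
    by (auto intro!: derivative_eq_intros)
  ultimately have "((\<lambda>t. g (?p t)) has_derivative
      (\<lambda>s. frechet_derivative g (at (?p t)) (s *\<^sub>R (y - x)))) (at t within T)" for t T
    by (rule has_derivative_in_compose[rotated])
  then obtain t where t: "t \<in> {0..1}"
      "g (?p 1) - g (?p 0) = frechet_derivative g (at (?p t)) ((1 - 0) *\<^sub>R (y - x))"
    using mvt_very_simple[of 0 1 "\<lambda>t. g (?p t)"
        "\<lambda>t s. frechet_derivative g (at (?p t)) (s *\<^sub>R (y - x))"] by auto
  show thesis
  proof
    show "?p t \<in> closed_segment x y"
      using t(1) by (auto simp: in_segment algebra_simps intro!: exI[of _ t])
    show "g y - g x = (\<Sum>i\<in>UNIV. (y - x) $ i * partial_deriv i g (?p t))"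
      using t(2) frechet_derivative_partial_sum[OF assms] by simp
  qed
qed

lemma abs_sum_le_norm_1:
  assumes "\<And>i. \<bar>a i\<bar> \<le> c"
  shows "\<bar>\<Sum>i\<in>UNIV. y $ i * a i\<bar> \<le> c * norm_1 y"
proof -
  have "\<bar>\<Sum>i\<in>UNIV. y $ i * a i\<bar> \<le> (\<Sum>i\<in>UNIV. \<bar>y $ i\<bar> * \<bar>a i\<bar>)"
    by (rule order_trans[OF sum_abs]) (simp add: abs_mult)
  also have "\<dots> \<le> (\<Sum>i\<in>UNIV. \<bar>y $ i\<bar> * c)"
    by (intro sum_mono mult_left_mono assms) simp
  finally show ?thesis
    by (simp add: norm_1_def sum_distrib_left mult_ac)
qed

lemma abs_diff_le_partial_bound:
  fixes g :: "real^'n \<Rightarrow> real"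
  assumes "\<And>z. g differentiable (at z)" and "convex S" "x \<in> S" "y \<in> S"
    and "\<And>z i. z \<in> S \<Longrightarrow> \<bar>partial_deriv i g z\<bar> \<le> c"
  shows "\<bar>g y - g x\<bar> \<le> c * norm_1 (y - x)"
proof -
  obtain z where z: "z \<in> closed_segment x y"
      "g y - g x = (\<Sum>i\<in>UNIV. (y - x) $ i * partial_deriv i g z)"
    using mean_value_partial_derivs[OF assms(1)] by blast
  have "z \<in> S"
    using z(1) assms(2-4) closed_segment_subset by blast
  then show ?thesis
    unfolding z(2) by (intro abs_sum_le_norm_1 assms)
qed

text \<open>The remainder is \<open>\<Sum>i. (y - x)_i (\<partial>_i g z - \<partial>_i g x)\<close> for a point \<open>z\<close> of the segment, and a
  second use of the mean value theorem bounds each difference of partial derivatives. Compared with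
  Taylor's formula this loses a factor 2.\<close>
lemma first_order_remainder_bound:
  fixes g :: "real^'n \<Rightarrow> real"
  assumes g: "C_k 2 g" and S: "convex S" "x \<in> S" "y \<in> S"
    and c: "\<And>z i j. z \<in> S \<Longrightarrow> \<bar>partial_deriv i (partial_deriv j g) z\<bar> \<le> c"
    and h: "norm (y - x) \<le> h"
  shows "\<bar>g y - g x - (\<Sum>i\<in>UNIV. (y - x) $ i * partial_deriv i g x)\<bar> \<le> real CARD('n) * c * h\<^sup>2"
proof -
  have diff: "g differentiable (at z)" "partial_deriv i g differentiable (at z)" for z i
    using g by (simp_all add: numeral_2_eq_2)
  have c0: "0 \<le> c"
    using c[OF S(2), of undefined undefined] by linarith
  obtain z where z: "z \<in> closed_segment x y"
      "g y - g x = (\<Sum>i\<in>UNIV. (y - x) $ i * partial_deriv i g z)"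
    using mean_value_partial_derivs[OF diff(1)] by blast
  have zS: "z \<in> S"
    using z(1) S closed_segment_subset by blast
  have zx: "norm_1 (z - x) \<le> norm_1 (y - x)"
  proof -
    obtain t where t: "0 \<le> t" "t \<le> 1" "z = (1 - t) *\<^sub>R x + t *\<^sub>R y"
      using z(1) by (auto simp: in_segment)
    then have "z - x = t *\<^sub>R (y - x)"
      by (simp add: algebra_simps)
    then have "norm_1 (z - x) = t * norm_1 (y - x)"
      using t(1) by (simp add: norm_1_def abs_mult sum_distrib_left)
    then show ?thesis
      using mult_right_mono[OF t(2) norm_1_nonneg[of "y - x"]] by simp
  qed
  have "\<bar>partial_deriv i g z - partial_deriv i g x\<bar> \<le> c * norm_1 (y - x)" for i
  proof -
    have "\<bar>partial_deriv i g z - partial_deriv i g x\<bar> \<le> c * norm_1 (z - x)"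
      by (rule abs_diff_le_partial_bound[OF diff(2) S(1,2) zS c])
    also have "\<dots> \<le> c * norm_1 (y - x)"
      by (rule mult_left_mono[OF zx c0])
    finally show ?thesis .
  qed
  then have "\<bar>\<Sum>i\<in>UNIV. (y - x) $ i * (partial_deriv i g z - partial_deriv i g x)\<bar>
      \<le> c * norm_1 (y - x) * norm_1 (y - x)"
    by (rule abs_sum_le_norm_1)
  also have "\<dots> = c * (norm_1 (y - x))\<^sup>2"
    by (simp add: power2_eq_square)
  also have "\<dots> \<le> c * (sqrt (real CARD('n)) * h)\<^sup>2"
    by (intro mult_left_mono power_mono norm_1_nonneg c0
        order_trans[OF norm_1_le_norm] h) simp
  finally show ?thesis
    unfolding z(2) by (simp add: sum_subtractf right_diff_distrib power_mult_distrib mult_ac)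
qed

section \<open>Errors of convex combinations\<close>

text \<open>A point \<open>x\<close> written as a convex combination of points of a convex region. In the application the region is a simplex of the refined
  triangulation, \<open>K\<close> its vertex set and \<open>h\<close> its diameter.\<close>
locale convex_combination =
  fixes S :: "(real^'n) set" and K :: "(real^'n) set" and u :: "real^'n \<Rightarrow> real"
    and x :: "real^'n" and h :: real
  assumes region: "convex S" "x \<in> S" "K \<subseteq> S"
    and weight_nonneg: "\<And>k. k \<in> K \<Longrightarrow> 0 \<le> u k" and weight_sum: "sum u K = 1"
    and point: "x = (\<Sum>k\<in>K. u k *\<^sub>R k)"
    and radius: "\<And>k. k \<in> K \<Longrightarrow> norm (k - x) \<le> h"
begin

lemma abs_mean_le:
  assumes "\<And>k. k \<in> K \<Longrightarrow> \<bar>a k\<bar> \<le> c"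
  shows "\<bar>\<Sum>k\<in>K. u k * a k\<bar> \<le> c"
proof -
  have "\<bar>\<Sum>k\<in>K. u k * a k\<bar> \<le> (\<Sum>k\<in>K. u k * c)"
    using assms weight_nonneg
    by (intro order_trans[OF sum_abs] sum_mono) (simp add: abs_mult mult_left_mono)
  then show ?thesis
    using weight_sum by (simp add: sum_distrib_right[symmetric])
qed

lemma mean_diff: "(\<Sum>k\<in>K. u k * a k) - c = (\<Sum>k\<in>K. u k * (a k - c))"
  using weight_sum by (simp add: right_diff_distrib sum_subtractf sum_distrib_right[symmetric])

lemma mean_offset_eq_0: "(\<Sum>k\<in>K. u k * (k - x) $ i) = 0"
proof -
  have "(\<Sum>k\<in>K. u k * k $ i) = x $ i"
    using arg_cong[OF point, of "\<lambda>y. y $ i"] by simp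
  then show ?thesis
    using mean_diff[of "\<lambda>k. k $ i" "x $ i"] by simp
qed

lemma mean_affine:
  assumes "\<And>k. k \<in> K \<Longrightarrow> p k - p x = w \<bullet> (k - x)"
  shows "(\<Sum>k\<in>K. u k * p k) = p x"
proof -
  have "(\<Sum>k\<in>K. u k * p k) - p x = (\<Sum>k\<in>K. u k * (w \<bullet> (k - x)))"
    unfolding mean_diff using assms by simp
  also have "\<dots> = (\<Sum>k\<in>K. \<Sum>i\<in>UNIV. w $ i * (u k * (k - x) $ i))"
    by (simp add: inner_vec_def sum_distrib_left mult_ac)
  also have "\<dots> = (\<Sum>i\<in>UNIV. w $ i * (\<Sum>k\<in>K. u k * (k - x) $ i))"
    unfolding sum_distrib_left by (rule sum.swap)
  finally show ?thesis
    by (simp add: mean_offset_eq_0 del: vector_minus_component)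
qed

text \<open>In the mean of the first-order expansions at \<open>x\<close> the linear terms cancel, because the offsets
  \<open>k - x\<close> have mean zero. This is why the error is of second order in \<open>h\<close>.\<close>
lemma interpolation_error:
  assumes g: "C_k 2 g"
    and c: "\<And>z i j. z \<in> S \<Longrightarrow> \<bar>partial_deriv i (partial_deriv j g) z\<bar> \<le> c"
  shows "\<bar>(\<Sum>k\<in>K. u k * g k) - g x\<bar> \<le> real CARD('n) * c * h\<^sup>2"
proof -
  let ?l = "\<lambda>k. \<Sum>i\<in>UNIV. (k - x) $ i * partial_deriv i g x"
  have "(\<Sum>k\<in>K. u k * ?l k) = (\<Sum>k\<in>K. \<Sum>i\<in>UNIV. partial_deriv i g x * (u k * (k - x) $ i))"
    by (simp add: sum_distrib_left mult_ac)
  also have "\<dots> = (\<Sum>i\<in>UNIV. partial_deriv i g x * (\<Sum>k\<in>K. u k * (k - x) $ i))"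
    unfolding sum_distrib_left by (rule sum.swap)
  finally have "(\<Sum>k\<in>K. u k * ?l k) = 0"
    by (simp add: mean_offset_eq_0 del: vector_minus_component)
  then have "(\<Sum>k\<in>K. u k * g k) - g x = (\<Sum>k\<in>K. u k * (g k - g x - ?l k))"
    unfolding mean_diff by (simp only: right_diff_distrib[of _ "_ - _"] sum_subtractf diff_zero)
  moreover have "\<bar>g k - g x - ?l k\<bar> \<le> real CARD('n) * c * h\<^sup>2" if "k \<in> K" for k
    using that region radius by (intro first_order_remainder_bound g c) auto
  ultimately show ?thesis
    using abs_mean_le[of "\<lambda>k. g k - g x - ?l k"] by presburger
qed

text \<open>If \<open>p\<close> is interpolated exactly, the error of \<open>p q\<close> is the covariance of \<open>p\<close> and \<open>q\<close>, the mean of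
  products of two deviations, plus \<open>p x\<close> times the error of \<open>q\<close>. The deviations being of first order
  in \<open>h\<close>, multiplication by an exactly interpolated factor keeps the error of second order.\<close>
lemma product_interpolation_error:
  assumes p: "(\<Sum>k\<in>K. u k * p k) = p x"
    and a: "\<And>k. k \<in> K \<Longrightarrow> \<bar>p k - p x\<bar> \<le> a" and b: "\<And>k. k \<in> K \<Longrightarrow> \<bar>q k - q x\<bar> \<le> b"
    and e: "\<bar>p x\<bar> \<le> r" "\<bar>(\<Sum>k\<in>K. u k * q k) - q x\<bar> \<le> e"
  shows "\<bar>(\<Sum>k\<in>K. u k * (p k * q k)) - p x * q x\<bar> \<le> a * b + r * e"
proof -
  have "(\<Sum>k\<in>K. u k * ((p k - p x) * (q k - q x)))
      = (\<Sum>k\<in>K. u k * (p k * q k) - p x * (u k * q k) - q x * (u k * p k) + p x * q x * u k)"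
    by (intro sum.cong refl) (simp add: algebra_simps)
  also have "\<dots> = (\<Sum>k\<in>K. u k * (p k * q k)) - p x * (\<Sum>k\<in>K. u k * q k) - q x * p x + p x * q x * 1"
    by (simp only: sum.distrib sum_subtractf sum_distrib_left[symmetric] p weight_sum)
  finally have "(\<Sum>k\<in>K. u k * (p k * q k)) - p x * q x
      = (\<Sum>k\<in>K. u k * ((p k - p x) * (q k - q x))) + p x * ((\<Sum>k\<in>K. u k * q k) - q x)"
    by (simp add: algebra_simps)
  moreover have "\<bar>\<Sum>k\<in>K. u k * ((p k - p x) * (q k - q x))\<bar> \<le> a * b"
  proof (rule abs_mean_le)
    fix k assume "k \<in> K"
    with a[OF this] b[OF this] show "\<bar>(p k - p x) * (q k - q x)\<bar> \<le> a * b"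
      by (simp add: abs_mult mult_mono')
  qed
  moreover have "\<bar>p x * ((\<Sum>k\<in>K. u k * q k) - q x)\<bar> \<le> r * e"
    using e by (simp add: abs_mult mult_mono')
  ultimately show ?thesis
    by linarith
qed

lemma inner_interpolation_error:
  fixes f :: "real^'n \<Rightarrow> real^'n"
  assumes f: "\<And>l. C_k 2 (\<lambda>y. f y $ l)"
    and c: "\<And>z i j l. z \<in> S \<Longrightarrow> \<bar>partial_deriv i (partial_deriv j (\<lambda>y. f y $ l)) z\<bar> \<le> c"
  shows "\<bar>(\<Sum>k\<in>K. u k * (w \<bullet> f k)) - w \<bullet> f x\<bar> \<le> real CARD('n) * c * h\<^sup>2 * norm_1 w"
proof -
  have "(\<Sum>k\<in>K. u k * (w \<bullet> f k)) = (\<Sum>k\<in>K. \<Sum>l\<in>UNIV. w $ l * (u k * f k $ l))"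
    by (simp add: inner_vec_def sum_distrib_left mult_ac)
  also have "\<dots> = (\<Sum>l\<in>UNIV. w $ l * (\<Sum>k\<in>K. u k * f k $ l))"
    unfolding sum_distrib_left by (rule sum.swap)
  finally have "(\<Sum>k\<in>K. u k * (w \<bullet> f k)) - w \<bullet> f x
      = (\<Sum>l\<in>UNIV. w $ l * ((\<Sum>k\<in>K. u k * f k $ l) - f x $ l))"
    by (simp add: inner_vec_def right_diff_distrib sum_subtractf)
  also have "\<bar>\<dots>\<bar> \<le> real CARD('n) * c * h\<^sup>2 * norm_1 w"
    by (intro abs_sum_le_norm_1 interpolation_error f c)
  finally show ?thesis .
qed

end

section \<open>Simplices of a triangulation and of its refinement\<close>

text \<open>If the ray from \<open>x\<close> does not start with a segment inside \<open>S\<close>, then its points near \<open>x\<close> all avoid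
  \<open>S\<close>: by convexity if \<open>x \<in> S\<close>, by closedness otherwise. Finitely many such sets cannot cover a
  neighbourhood of \<open>x\<close>.\<close>
lemma ex_direction_simplex:
  fixes x d :: "'a::real_normed_vector"
  assumes fin: "finite \<T>" and "\<And>S. S \<in> \<T> \<Longrightarrow> closed S" "\<And>S. S \<in> \<T> \<Longrightarrow> convex S"
    and x: "x \<in> interior (\<Union>\<T>)"
  shows "\<exists>S\<in>\<T>. \<exists>b>0. \<forall>t\<in>{0..b}. x + t *\<^sub>R d \<in> S"
proof (rule ccontr)
  assume "\<not> ?thesis"
  then have leaves: "\<exists>t\<in>{0..b}. x + t *\<^sub>R d \<notin> S" if "S \<in> \<T>" "0 < b" for S b
    using that by blast
  have lim: "((\<lambda>t. x + t *\<^sub>R d) \<longlongrightarrow> x) (at_right 0)"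
    by (auto intro!: tendsto_eq_intros)
  have "\<forall>\<^sub>F t in at_right 0. x + t *\<^sub>R d \<notin> S" if S: "S \<in> \<T>" for S
  proof (cases "x \<in> S")
    case True
    have "x + t *\<^sub>R d \<notin> S" if t: "0 < t" for t
    proof
      assume "x + t *\<^sub>R d \<in> S"
      obtain s where s: "s \<in> {0..t}" "x + s *\<^sub>R d \<notin> S"
        using leaves[OF S t] by blast
      have "(1 - s / t) *\<^sub>R x + (s / t) *\<^sub>R (x + t *\<^sub>R d) \<in> S"
        using assms(3)[OF S] True \<open>x + t *\<^sub>R d \<in> S\<close> s(1) t by (intro convexD) auto
      moreover have "(1 - s / t) *\<^sub>R x + (s / t) *\<^sub>R (x + t *\<^sub>R d) = x + s *\<^sub>R d"
        using t by (simp add: algebra_simps)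
      ultimately show False
        using s(2) by simp
    qed
    then show ?thesis
      by (rule eventually_mono[OF eventually_at_right_less])
  next
    case False
    then show ?thesis
      using topological_tendstoD[OF lim, of "- S"] assms(2)[OF S] by auto
  qed
  then have "\<forall>\<^sub>F t in at_right 0. \<forall>S\<in>\<T>. x + t *\<^sub>R d \<notin> S"
    using fin by (simp add: eventually_ball_finite)
  moreover have "\<forall>\<^sub>F t in at_right 0. x + t *\<^sub>R d \<in> interior (\<Union>\<T>)"
    using topological_tendstoD[OF lim open_interior x] .
  ultimately have "\<forall>\<^sub>F t in at_right (0::real). False"
    by eventually_elim (use interior_subset in blast)
  then show False
    by simp
qed

lemma triangulation_simplex:
  fixes \<T> :: "(real^'n) set set"
  assumes "is_triangulation \<T>" "S \<in> \<T>"
  shows "int CARD('n) simplex S"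
  using assms by (auto simp: is_triangulation_def)

lemma orbital_simplex_mem:
  assumes T: "is_triangulation \<T>" and x: "x \<in> interior (\<Union>\<T>)"
  shows "orbital_simplex f \<T> x \<in> \<T>" and "x \<in> orbital_simplex f \<T> x"
proof -
  let ?P = "\<lambda>S. S \<in> \<T> \<and> (\<exists>b>0. \<forall>t\<in>{0..b}. x + t *\<^sub>R f x \<in> S)"
  have "finite \<T>"
    using T by (simp add: is_triangulation_def)
  then have "\<exists>S\<in>\<T>. \<exists>b>0. \<forall>t\<in>{0..b}. x + t *\<^sub>R f x \<in> S"
    by (rule ex_direction_simplex[OF _ _ _ x])
      (use T in \<open>auto dest: triangulation_simplex closed_simplex convex_simplex\<close>)
  then have "\<exists>S. ?P S"
    by (simp only: Bex_def)
  then have P: "?P (orbital_simplex f \<T> x)"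
    unfolding orbital_simplex_def by (rule someI_ex)
  then show "orbital_simplex f \<T> x \<in> \<T>" ..
  from P obtain b where "b > 0" "\<forall>t\<in>{0..b}. x + t *\<^sub>R f x \<in> orbital_simplex f \<T> x"
    by blast
  then show "x \<in> orbital_simplex f \<T> x"
    by (auto dest: bspec[of _ _ 0])
qed

lemma simplex_interior_nonempty:
  fixes S :: "(real^'n) set"
  assumes "int CARD('n) simplex S"
  shows "interior S \<noteq> {}"
proof -
  have "aff_dim S = int DIM(real^'n)"
    using aff_dim_simplex[OF assms] by simp
  moreover have "S \<noteq> {}"
    using assms by (auto simp: simplex_empty)
  ultimately show ?thesis
    using convex_simplex[OF assms] by (simp add: interior_rel_interior_gen rel_interior_eq_empty)
qed

lemma simplex_face_disjoint_interior:
  assumes S: "m simplex S" and F: "simplex_face F S"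
  shows "F \<inter> interior S = {}"
proof -
  let ?V = "simplex_vertices S"
  note V = simplex_vertices_simplex[OF S]
  obtain C where C: "C \<subset> ?V" "F = convex hull C"
    using F by (auto simp: simplex_face_def)
  have "\<not> affine_dependent C"
    using affine_independent_subset[OF V(2)] C(1) by blast
  then have "simplex_vertices F = C"
    unfolding C(2) by (rule simplex_vertices_convex_hull)
  then have "F \<noteq> S"
    using C(1) by blast
  moreover have "F face_of convex hull ?V"
    using face_of_convex_hull_affine_independent[OF V(2)] C by blast
  ultimately show ?thesis
    unfolding V(3)[symmetric] by (intro face_of_disjoint_interior)
qed

text \<open>Two different simplices meet in a proper face, which contains no interior point.\<close>
lemma triangulation_interior_unique:
  assumes T: "is_triangulation \<T>" and "S \<in> \<T>" "S' \<in> \<T>" and y: "y \<in> interior S" "y \<in> S'"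
  shows "S = S'"
proof (rule ccontr)
  assume "S \<noteq> S'"
  moreover have "y \<in> S \<inter> S'"
    using y interior_subset by blast
  ultimately have "simplex_face (S \<inter> S') S"
    using assms unfolding is_triangulation_def by blast
  then show False
    using simplex_face_disjoint_interior[OF triangulation_simplex[OF T \<open>S \<in> \<T>\<close>]] \<open>y \<in> S \<inter> S'\<close> y(1)
    by blast
qed

text \<open>An interior point \<open>y\<close> of \<open>S\<close> lies in some coarse simplex \<open>N\<close>. As \<open>N\<close> is a union of fine
  simplices and \<open>S\<close> is the only fine simplex through \<open>y\<close>, it is one of those whose union is \<open>N\<close>.\<close>
lemma coarse_simplex_mem:
  assumes T: "is_triangulation \<T>" and R: "is_refinement \<T>' \<T>" and S: "S \<in> \<T>'"
  shows "coarse_simplex \<T> S \<in> \<T>" and "S \<subseteq> coarse_simplex \<T> S"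
proof -
  have T': "is_triangulation \<T>'"
    using R by (simp add: is_refinement_def)
  obtain y where y: "y \<in> interior S"
    using simplex_interior_nonempty[OF triangulation_simplex[OF T' S]] by blast
  have "y \<in> \<Union>\<T>"
  proof -
    have "y \<in> S"
      using y interior_subset by blast
    then have "y \<in> \<Union>\<T>'"
      using S by blast
    then show ?thesis
      using R unfolding is_refinement_def by metis
  qed
  then obtain N where N: "N \<in> \<T>" "y \<in> N"
    by blast
  then obtain \<U> where U: "\<U> \<subseteq> \<T>'" "N = \<Union>\<U>"
    using R by (auto simp: is_refinement_def)
  then obtain S' where "S' \<in> \<U>" "y \<in> S'"
    using N(2) by blast
  then have "S = S'"
    using triangulation_interior_unique[OF T' S _ y] U by blast
  then have "S \<subseteq> N"
    using \<open>S' \<in> \<U>\<close> U by blast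
  have unique: "N' = N" if "N' \<in> \<T> \<and> S \<subseteq> N'" for N'
  proof -
    have "y \<in> interior N"
      using y interior_mono[OF \<open>S \<subseteq> N\<close>] by blast
    moreover have "y \<in> N'"
      using y that interior_subset by blast
    ultimately show ?thesis
      using triangulation_interior_unique[OF T N(1)] that by blast
  qed
  have "coarse_simplex \<T> S = N"
    unfolding coarse_simplex_def
  proof (rule the_equality)
    show "N \<in> \<T> \<and> S \<subseteq> N"
      using N(1) \<open>S \<subseteq> N\<close> ..
  qed (rule unique)
  then show "coarse_simplex \<T> S \<in> \<T>" "S \<subseteq> coarse_simplex \<T> S"
    using N(1) \<open>S \<subseteq> N\<close> by auto
qed

section \<open>The interpolation is affine on each simplex\<close>

lemma barycentric_exists:
  assumes S: "m simplex S" and x: "x \<in> S"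
  obtains u where "barycentric S u x"
proof -
  note V = simplex_vertices_simplex[OF S]
  obtain u where u: "\<forall>v\<in>simplex_vertices S. 0 \<le> u v" "sum u (simplex_vertices S) = 1"
      "(\<Sum>v\<in>simplex_vertices S. u v *\<^sub>R v) = x"
  proof -
    have "x \<in> convex hull simplex_vertices S"
      unfolding V(3)[symmetric] by (rule x)
    then show thesis
      using that unfolding convex_hull_finite[OF V(1)] by blast
  qed
  have "u v \<le> 1" if "v \<in> simplex_vertices S" for v
    using member_le_sum[OF that, of u] u(1,2) V(1) by auto
  then have "barycentric S u x"
    using u(1,2) u(3)[symmetric] unfolding barycentric_def by blast
  then show thesis
    by (rule that)
qed

lemma simplex_vertices_subset:
  assumes "m simplex S"
  shows "simplex_vertices S \<subseteq> S"
proof -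
  have "simplex_vertices S \<subseteq> convex hull simplex_vertices S"
    by (rule hull_subset)
  then show ?thesis
    unfolding simplex_vertices_simplex(3)[OF assms, symmetric] .
qed

lemma barycentric_vertex:
  assumes S: "m simplex S" and v: "v \<in> simplex_vertices S"
  shows "barycentric S (\<lambda>w. if w = v then 1 else 0) v"
  using v simplex_vertices_simplex(1)[OF S]
  by (simp add: barycentric_def if_distrib[of "\<lambda>a. a *\<^sub>R _"] cong: if_cong)

lemma cpa_vertex:
  assumes T: "is_triangulation \<T>" "S \<in> \<T>" and v: "v \<in> simplex_vertices S"
  shows "cpa \<T> g v = g v"
  using cpa_eqI[OF T barycentric_vertex[OF triangulation_simplex[OF T] v], of g] v
    simplex_vertices_simplex(1)[OF triangulation_simplex[OF T]]
  by (simp add: if_distrib[of "\<lambda>a. a *\<^sub>R _"] cong: if_cong)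

text \<open>The differences from one fixed vertex \<open>a\<close> are linearly independent, so the prescribed increments
  \<open>b v - b a\<close> extend to a linear functional, which is an inner product with some \<open>w\<close>.\<close>
lemma barycentric_interpolation_affine:
  fixes S :: "(real^'n) set" and b :: "real^'n \<Rightarrow> real"
  assumes S: "m simplex S" and "S \<noteq> {}"
  obtains c w where "\<And>u x. barycentric S u x \<Longrightarrow> (\<Sum>v\<in>simplex_vertices S. u v * b v) = c + w \<bullet> x"
proof -
  let ?V = "simplex_vertices S"
  note V = simplex_vertices_simplex[OF S]
  have "convex hull ?V \<noteq> {}"
    unfolding V(3)[symmetric] by (rule \<open>S \<noteq> {}\<close>)
  then obtain a where a: "a \<in> ?V"
    by auto
  have "independent ((\<lambda>v. - a + v) ` (?V - {a}))"
    using V(2) affine_dependent_iff_dependent2[OF a] by blast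
  from linear_independent_extend[OF this, of "\<lambda>y. b (a + y) - b a"]
  obtain L where L: "linear L"
      "\<forall>y\<in>(\<lambda>v. - a + v) ` (?V - {a}). L y = b (a + y) - b a"
    by blast
  have b: "b v = b a + L (v - a)" if "v \<in> ?V" for v
  proof (cases "v = a")
    case True
    then show ?thesis using linear_0[OF L(1)] by simp
  next
    case False
    then have "- a + v \<in> (\<lambda>v. - a + v) ` (?V - {a})"
      using that by (intro imageI) simp
    from bspec[OF L(2) this] show ?thesis by simp
  qed
  define w where "w = adjoint L 1"
  have w: "L y = w \<bullet> y" for y
    using adjoint_works[OF L(1), of y 1] by (simp add: w_def inner_commute[of _ y])
  show thesis
  proof
    fix u x assume u: "barycentric S u x"
    have "(\<Sum>v\<in>?V. u v * b v) = (\<Sum>v\<in>?V. u v * (b a - w \<bullet> a) + w \<bullet> (u v *\<^sub>R v))"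
      by (intro sum.cong refl) (simp add: b w inner_diff_right algebra_simps)
    also have "\<dots> = (\<Sum>v\<in>?V. u v) * (b a - w \<bullet> a) + w \<bullet> (\<Sum>v\<in>?V. u v *\<^sub>R v)"
      by (simp only: sum.distrib sum_distrib_right inner_sum_right)
    also have "\<dots> = (b a - w \<bullet> a) + w \<bullet> x"
      using u unfolding barycentric_def by simp
    finally show "(\<Sum>v\<in>?V. u v * b v) = (b a - w \<bullet> a) + w \<bullet> x" .
  qed
qed

text \<open>Only the values of \<open>G\<close> on \<open>S\<close> are prescribed, so the lemma applies to the interpolations
  themselves and to the entries of a matrix-valued one.\<close>
lemma simplex_gradient_interpolation:
  fixes S :: "(real^'n) set"
  assumes S: "int CARD('n) simplex S"
    and G: "\<And>u x. barycentric S u x \<Longrightarrow> G x = (\<Sum>v\<in>simplex_vertices S. u v * b v)"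
    and "x \<in> S" "y \<in> S"
  shows "G y - G x = simplex_gradient S G \<bullet> (y - x)"
proof -
  obtain c w where cw: "\<And>u x. barycentric S u x \<Longrightarrow> (\<Sum>v\<in>simplex_vertices S. u v * b v) = c + w \<bullet> x"
    using barycentric_interpolation_affine[OF S, of b] \<open>x \<in> S\<close> by blast
  have G': "G z = c + w \<bullet> z" if z: "z \<in> S" for z
    using barycentric_exists[OF S z] G cw by metis
  then have "simplex_gradient S G = w"
    by (rule simplex_gradient_eqI[OF S])
  then show ?thesis
    using assms(3,4) by (simp add: G' inner_diff_right)
qed

lemma cpa_diff_eq_gradient:
  assumes T: "is_triangulation \<T>" "S \<in> \<T>" and "x \<in> S" "y \<in> S"
  shows "cpa \<T> g y - cpa \<T> g x = simplex_gradient S (cpa \<T> g) \<bullet> (y - x)"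
  by (rule simplex_gradient_interpolation[OF triangulation_simplex[OF T] _ assms(3,4), of _ g])
    (simp add: cpa_eqI[OF T])

lemma cpa_entry:
  fixes P :: "real^'n \<Rightarrow> real^'k^'m"
  assumes T: "is_triangulation \<T>" "S \<in> \<T>" and u: "barycentric S u x"
  shows "cpa \<T> P x $ i $ j = (\<Sum>v\<in>simplex_vertices S. u v * P v $ i $ j)"
  by (simp add: cpa_eqI[OF T u])

lemma cpa_entry_diff_eq_grad_P:
  assumes T: "is_triangulation \<T>" "S \<in> \<T>" and "x \<in> S" "y \<in> S"
  shows "cpa \<T> P y $ i $ j - cpa \<T> P x $ i $ j = grad_P \<T> P S i j \<bullet> (y - x)"
  unfolding grad_P_def
  by (rule simplex_gradient_interpolation[OF triangulation_simplex[OF T] _ assms(3,4)])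
    (rule cpa_entry[OF T])

lemma grad_P_cong:
  assumes T: "is_triangulation \<T>" "S \<in> \<T>"
    and eq: "\<And>y. y \<in> S \<Longrightarrow> cpa \<T> P y $ i $ j = cpa \<T> P y $ k $ l"
  shows "grad_P \<T> P S i j = grad_P \<T> P S k l"
proof -
  obtain x where "x \<in> S"
    using simplex_interior_nonempty[OF triangulation_simplex[OF T]] interior_subset by blast
  have "cpa \<T> P y $ i $ j = (cpa \<T> P x $ k $ l - grad_P \<T> P S k l \<bullet> x) + grad_P \<T> P S k l \<bullet> y"
    if "y \<in> S" for y
    using cpa_entry_diff_eq_grad_P[OF T \<open>x \<in> S\<close> that, of P k l] eq[OF that] by (simp add: inner_diff_right)
  then have "simplex_gradient S (\<lambda>y. cpa \<T> P y $ i $ j) = grad_P \<T> P S k l"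
    by (rule simplex_gradient_eqI[OF triangulation_simplex[OF T]])
  then show ?thesis
    by (simp add: grad_P_def)
qed

section \<open>Interpolation error of the matrix A\<close>

lemma A_on_entry:
  fixes f :: "real^'n \<Rightarrow> real^'n"
  assumes "f differentiable (at y)"
  shows "A_on f \<T> P N y $ i $ j =
      (\<Sum>l\<in>UNIV. cpa \<T> P y $ i $ l * partial_deriv j (\<lambda>z. f z $ l) y)
    + (\<Sum>l\<in>UNIV. cpa \<T> P y $ l $ j * partial_deriv i (\<lambda>z. f z $ l) y)
    + grad_P \<T> P N i j \<bullet> f y"
proof -
  have "(\<Sum>l\<in>UNIV. jacobian f (at y) $ l $ i * cpa \<T> P y $ l $ j)
      = (\<Sum>l\<in>UNIV. cpa \<T> P y $ l $ j * partial_deriv i (\<lambda>z. f z $ l) y)"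
    by (rule sum.cong[OF refl]) (simp only: jacobian_entry[OF assms] mult.commute)
  then show ?thesis
    unfolding A_on_def matrix_matrix_mult_def transpose_def vector_add_component vec_lambda_beta
      jacobian_entry[OF assms] by (rule arg_cong)
qed

text \<open>The entry is a sum of \<open>n\<close> products \<open>P_il \<partial>_j f_l\<close>, \<open>n\<close> products \<open>P_lj \<partial>_i f_l\<close> and one term linear
  in \<open>f\<close>. Each product contributes at most \<open>sqrt n c2 d h^2\<close> from the covariance of \<open>P\<close> and \<open>Df\<close>, and
  \<open>n c3 r h^2\<close> from the interpolation error of \<open>Df\<close>; the linear term contributes \<open>n c2 d h^2\<close>. The
  gradients of \<open>P\<close> are those on \<open>N\<close>, but \<open>h\<close> measures \<open>S\<close>: this is why the constraints on a refinement
  can use the smaller diameters.\<close>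
lemma (in convex_combination) A_on_interpolation_error:
  fixes f :: "real^'n \<Rightarrow> real^'n" and P :: "real^'n \<Rightarrow> real^'n^'n"
  assumes T: "is_triangulation \<T>" "N \<in> \<T>" "S \<subseteq> N"
    and f: "C_k 3 f"
    and c2: "\<And>z i j l. z \<in> S \<Longrightarrow> \<bar>partial_deriv i (partial_deriv j (\<lambda>y. f y $ l)) z\<bar> \<le> c2"
    and c3: "\<And>z i j k l. z \<in> S \<Longrightarrow>
      \<bar>partial_deriv i (partial_deriv j (partial_deriv k (\<lambda>y. f y $ l))) z\<bar> \<le> c3"
    and d: "\<And>i j. norm_1 (grad_P \<T> P N i j) \<le> d"
    and r: "\<And>i j. \<bar>cpa \<T> P x $ i $ j\<bar> \<le> r"
  shows "\<bar>(\<Sum>k\<in>K. u k * A_on f \<T> P N k $ i $ j) - A_on f \<T> P N x $ i $ j\<bar>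
    \<le> h\<^sup>2 * (real CARD('n) * ((1 + 2 * sqrt (real CARD('n))) * c2 * d + 2 * real CARD('n) * c3 * r))"
proof -
  let ?n = "real CARD('n)"
  let ?e = "d * h * (c2 * (sqrt ?n * h)) + r * (?n * c3 * h\<^sup>2)"
  have Cf: "C_k 3 (\<lambda>y. f y $ l)" for l
    by (rule C_k_component[OF f])
  have C2: "C_k 2 (partial_deriv j (\<lambda>y. f y $ l))" for j l
    using Cf by (simp add: numeral_eq_Suc)
  have c20: "0 \<le> c2"
    using c2[OF region(2), of undefined undefined undefined] by linarith
  have K: "k \<in> S" "k \<in> N" "x \<in> N" if "k \<in> K" for k
    using that region T(3) by auto
  have meanP: "(\<Sum>k\<in>K. u k * cpa \<T> P k $ a $ b) = cpa \<T> P x $ a $ b" for a b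
    by (rule mean_affine[where p = "\<lambda>y. cpa \<T> P y $ a $ b"]) (rule cpa_entry_diff_eq_grad_P[OF T(1,2)]; use K in blast)
  have product: "\<bar>(\<Sum>k\<in>K. u k * (cpa \<T> P k $ a $ b * partial_deriv j (\<lambda>y. f y $ l) k))
      - cpa \<T> P x $ a $ b * partial_deriv j (\<lambda>y. f y $ l) x\<bar> \<le> ?e" for a b j l
  proof (rule product_interpolation_error[where p = "\<lambda>y. cpa \<T> P y $ a $ b"])
    show "(\<Sum>k\<in>K. u k * cpa \<T> P k $ a $ b) = cpa \<T> P x $ a $ b"
      by (rule meanP)
    show "\<bar>cpa \<T> P x $ a $ b\<bar> \<le> r"
      by (rule r)
    show "\<bar>(\<Sum>k\<in>K. u k * partial_deriv j (\<lambda>y. f y $ l) k) - partial_deriv j (\<lambda>y. f y $ l) x\<bar> \<le> ?n * c3 * h\<^sup>2"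
      by (rule interpolation_error[OF C2 c3])
  next
    fix k assume k: "k \<in> K"
    show "\<bar>cpa \<T> P k $ a $ b - cpa \<T> P x $ a $ b\<bar> \<le> d * h"
      unfolding cpa_entry_diff_eq_grad_P[OF T(1,2) K(3,2)[OF k]] by (rule abs_inner_le_norm_1[OF d radius[OF k]])
    have "\<bar>partial_deriv j (\<lambda>y. f y $ l) k - partial_deriv j (\<lambda>y. f y $ l) x\<bar> \<le> c2 * norm_1 (k - x)"
      using C2 by (intro abs_diff_le_partial_bound[OF _ region(1,2) K(1)[OF k] c2]) (simp add: numeral_2_eq_2)
    also have "\<dots> \<le> c2 * (sqrt ?n * h)"
      by (intro mult_left_mono c20 order_trans[OF norm_1_le_norm] radius k) simp
    finally show "\<bar>partial_deriv j (\<lambda>y. f y $ l) k - partial_deriv j (\<lambda>y. f y $ l) x\<bar> \<le> c2 * (sqrt ?n * h)" .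
  qed
  have products: "\<bar>(\<Sum>k\<in>K. u k * (\<Sum>l\<in>UNIV. cpa \<T> P k $ a l $ b l * partial_deriv j (\<lambda>y. f y $ l) k))
      - (\<Sum>l\<in>UNIV. cpa \<T> P x $ a l $ b l * partial_deriv j (\<lambda>y. f y $ l) x)\<bar> \<le> ?n * ?e" for a b j
  proof -
    let ?t = "\<lambda>l. (\<Sum>k\<in>K. u k * (cpa \<T> P k $ a l $ b l * partial_deriv j (\<lambda>y. f y $ l) k))
      - cpa \<T> P x $ a l $ b l * partial_deriv j (\<lambda>y. f y $ l) x"
    have "(\<Sum>k\<in>K. u k * (\<Sum>l\<in>UNIV. cpa \<T> P k $ a l $ b l * partial_deriv j (\<lambda>y. f y $ l) k))
      - (\<Sum>l\<in>UNIV. cpa \<T> P x $ a l $ b l * partial_deriv j (\<lambda>y. f y $ l) x) = (\<Sum>l\<in>UNIV. ?t l)"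
      unfolding sum_distrib_left sum_subtractf by (subst sum.swap) (rule refl)
    also have "\<bar>\<dots>\<bar> \<le> (\<Sum>l\<in>(UNIV::'n set). ?e)"
      by (rule order_trans[OF sum_abs]) (intro sum_mono product)
    finally show ?thesis
      by simp
  qed
  have "C_k 2 (\<lambda>y. f y $ l)" for l
    by (rule C_k_SucD) (use Cf[of l] in \<open>simp add: numeral_eq_Suc\<close>)
  then have "\<bar>(\<Sum>k\<in>K. u k * (grad_P \<T> P N i j \<bullet> f k)) - grad_P \<T> P N i j \<bullet> f x\<bar>
      \<le> ?n * c2 * h\<^sup>2 * norm_1 (grad_P \<T> P N i j)"
    by (intro inner_interpolation_error c2)
  also have "\<dots> \<le> ?n * c2 * h\<^sup>2 * d"
    by (intro mult_left_mono d) (simp add: c20)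
  finally have inner: "\<bar>(\<Sum>k\<in>K. u k * (grad_P \<T> P N i j \<bullet> f k)) - grad_P \<T> P N i j \<bullet> f x\<bar>
      \<le> ?n * c2 * h\<^sup>2 * d" .
  have "f differentiable (at y)" for y
    using f by (simp add: numeral_eq_Suc)
  note entry = A_on_entry[OF this]
  have "\<bar>(\<Sum>k\<in>K. u k * A_on f \<T> P N k $ i $ j) - A_on f \<T> P N x $ i $ j\<bar>
      \<le> ?n * ?e + ?n * ?e + ?n * c2 * h\<^sup>2 * d"
    using products[of "\<lambda>_. i" "\<lambda>l. l" j] products[of "\<lambda>l. l" "\<lambda>_. j" i] inner
    unfolding entry distrib_left sum.distrib by linarith
  also have "\<dots> = h\<^sup>2 * (?n * ((1 + 2 * sqrt ?n) * c2 * d + 2 * ?n * c3 * r))"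
    by (simp add: algebra_simps power2_eq_square)
  finally show ?thesis .
qed

section \<open>From the vertices to the interior\<close>

theorem theorem4p12:
  fixes f :: "real^'n \<Rightarrow> real^'n"
    and \<T> \<T>' :: "(real^'n) set set"
    and \<mu> \<epsilon>\<^sub>0 m Q :: real
    and B B3 C D B' D\<^sub>\<mu> D\<^sub>V :: "(real^'n) set \<Rightarrow> real"
    and P :: "real^'n \<Rightarrow> real^'n^'n"
    and \<mu>' V :: "real^'n \<Rightarrow> real"
  assumes "C_k 3 f"
    and "is_triangulation \<T>"
    and "\<mu> \<ge> 0"
    and "\<epsilon>\<^sub>0 > 0"
    and "bounds_second f \<T> B"
    and "bounds_third f \<T> B3"
    and "feasible_1 f \<T> \<mu> \<epsilon>\<^sub>0 B B3 P C D"
    and "is_refinement \<T>' \<T>"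
    and "\<forall>x\<in>interior (\<Union>\<T>'). real (num_pos_gen_eigenvalues (A_at f \<T> \<T>' P x) (cpa \<T> P x)) \<le> m"
    and "bounds_second f \<T>' B'"
    and "feasible_2 f \<T> \<T>' m P D (E_const B B3 C D) B' \<mu>' V D\<^sub>\<mu> D\<^sub>V Q"
  shows "\<forall>x\<in>interior (\<Union>\<T>').
    A_at f \<T> \<T>' P x - cpa \<T>' \<mu>' x *\<^sub>R cpa \<T> P x \<preceq>\<^sub>L 0 \<and>
    V_dot f \<T>' V x + m * cpa \<T>' \<mu>' x \<le> Q"
proof
  fix x assume x: "x \<in> interior (\<Union>\<T>')"
  let ?n = "real CARD('n)"
  \<comment> \<open>The fine simplex \<open>S\<close> and the coarse simplex \<open>N\<close> whose gradients enter the orbital derivatives.\<close>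
  define S where "S = orbital_simplex f \<T>' x"
  define N where "N = coarse_simplex \<T> S"
  define K where "K = simplex_vertices S"
  define h where "h = diameter S"
  note T = \<open>is_triangulation \<T>\<close>
  have T': "is_triangulation \<T>'"
    using \<open>is_refinement \<T>' \<T>\<close> by (simp add: is_refinement_def)
  have S: "S \<in> \<T>'" "x \<in> S"
    using orbital_simplex_mem[OF T' x] by (simp_all add: S_def)
  have N: "N \<in> \<T>" "S \<subseteq> N"
    using coarse_simplex_mem[OF T \<open>is_refinement \<T>' \<T>\<close> S(1)] by (simp_all add: N_def)
  note simplexS = triangulation_simplex[OF T' S(1)] and simplexN = triangulation_simplex[OF T N(1)]
  have KS: "K \<subseteq> S"
    unfolding K_def by (rule simplex_vertices_subset[OF simplexS])
  obtain u where u: "barycentric S u x"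
    using barycentric_exists[OF simplexS S(2)] by blast
  interpret convex_combination S K u x h
  proof
    show "norm (k - x) \<le> h" if "k \<in> K" for k
      using diameter_bounded_bound[OF compact_imp_bounded[OF compact_simplex[OF simplexS]], of k x]
        that KS S(2) by (auto simp: h_def dist_norm)
  qed (use u S KS convex_simplex[OF simplexS] in \<open>auto simp: barycentric_def K_def\<close>)

  have f1: "0 \<le> C N" "0 \<le> D N" "norm_1 (grad_P \<T> P N i j) \<le> D N" for i j
    using \<open>feasible_1 f \<T> \<mu> \<epsilon>\<^sub>0 B B3 P C D\<close> N(1) by (auto simp: feasible_1_def)
  have Pv: "symmetric_matrix (P v)" "\<bar>P v $ i $ j\<bar> \<le> C N" if "v \<in> simplex_vertices N" for v i j
  proof -
    have *: "symmetric_matrix (P v)" "mat \<epsilon>\<^sub>0 \<preceq>\<^sub>L P v" "P v \<preceq>\<^sub>L mat (C N)"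
      using \<open>feasible_1 f \<T> \<mu> \<epsilon>\<^sub>0 B B3 P C D\<close> N(1) that by (auto simp: feasible_1_def)
    then show "symmetric_matrix (P v)"
      by simp
    have "0 \<le> w \<bullet> (P v *v w)" for w
      using loewner_le_quadratic_form[OF *(2), of w] \<open>\<epsilon>\<^sub>0 > 0\<close>
      by (auto simp: quadratic_form_mat intro: order_trans[rotated])
    then have "mat 0 \<preceq>\<^sub>L P v"
      using *(1) by (simp add: loewner_le_def psd_def)
    then show "\<bar>P v $ i $ j\<bar> \<le> C N"
      using entry_le_loewner_bound * by blast
  qed
  have f2: "0 \<le> D\<^sub>\<mu> S" "infnorm (simplex_gradient S (cpa \<T>' \<mu>')) \<le> D\<^sub>\<mu> S"
      "norm_1 (simplex_gradient S (cpa \<T>' V)) \<le> D\<^sub>V S"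
    and A_vertex: "\<And>v. v \<in> K \<Longrightarrow> A_on f \<T> P N v - \<mu>' v *\<^sub>R cpa \<T> P v
        + mat (h\<^sup>2 * (E_const B B3 C D N + 2 * ?n * sqrt ?n * D N * D\<^sub>\<mu> S)) \<preceq>\<^sub>L 0"
    and V_vertex: "\<And>v. v \<in> K \<Longrightarrow> simplex_gradient S (cpa \<T>' V) \<bullet> f v
        + h\<^sup>2 * ?n * B' S * D\<^sub>V S + m * \<mu>' v \<le> Q"
    using \<open>feasible_2 f \<T> \<T>' m P D (E_const B B3 C D) B' \<mu>' V D\<^sub>\<mu> D\<^sub>V Q\<close> S(1)
    unfolding feasible_2_def Let_def N_def K_def h_def by blast+

  have bounds: "\<bar>partial_deriv i (partial_deriv j (\<lambda>y. f y $ l)) z\<bar> \<le> B N"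
      "\<bar>partial_deriv i (partial_deriv j (partial_deriv k (\<lambda>y. f y $ l))) z\<bar> \<le> B3 N"
      "\<bar>partial_deriv i (partial_deriv j (\<lambda>y. f y $ l)) z\<bar> \<le> B' S" if "z \<in> S" for z i j k l
  proof -
    have "z \<in> N"
      using that N(2) by blast
    with N(1) S(1) that assms(5,6,10) show
      "\<bar>partial_deriv i (partial_deriv j (\<lambda>y. f y $ l)) z\<bar> \<le> B N"
      "\<bar>partial_deriv i (partial_deriv j (partial_deriv k (\<lambda>y. f y $ l))) z\<bar> \<le> B3 N"
      "\<bar>partial_deriv i (partial_deriv j (\<lambda>y. f y $ l)) z\<bar> \<le> B' S"
      by (simp_all add: bounds_second_def bounds_third_def)
  qed
  have "0 \<le> B N" "0 \<le> B' S"
    using bounds(1,3)[OF S(2), of undefined undefined undefined] by linarith+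
  have "C_k 2 (\<lambda>y. f y $ l)" for l
    by (rule C_k_SucD) (use C_k_component[OF \<open>C_k 3 f\<close>, of l] in \<open>simp add: numeral_eq_Suc\<close>)
  note f_error = inner_interpolation_error[OF this bounds(3)]

  have \<mu>K: "cpa \<T>' \<mu>' k = \<mu>' k" if "k \<in> K" for k
    using cpa_vertex[OF T' S(1)] that by (simp add: K_def)
  have \<mu>x: "cpa \<T>' \<mu>' x = (\<Sum>k\<in>K. u k * \<mu>' k)"
    using cpa_eqI[OF T' S(1) u, of \<mu>'] by (simp add: K_def)

  have P_sym: "cpa \<T> P y $ i $ j = cpa \<T> P y $ j $ i"
    and P_bound: "\<bar>cpa \<T> P y $ i $ j\<bar> \<le> C N" if y: "y \<in> N" for y i j
  proof -
    obtain t where t: "barycentric N t y"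
      using barycentric_exists[OF simplexN y] by blast
    note entry = cpa_entry[OF T N(1) t, of P]
    show "cpa \<T> P y $ i $ j = cpa \<T> P y $ j $ i"
      unfolding entry using Pv(1) by (intro sum.cong refl) (metis symmetric_matrix_iff)
    have "\<bar>cpa \<T> P y $ i $ j\<bar> \<le> (\<Sum>v\<in>simplex_vertices N. t v * C N)"
      unfolding entry using t Pv(2)
      by (intro order_trans[OF sum_abs] sum_mono) (auto simp: barycentric_def abs_mult intro!: mult_left_mono)
    then show "\<bar>cpa \<T> P y $ i $ j\<bar> \<le> C N"
      using t by (simp add: barycentric_def sum_distrib_right[symmetric])
  qed
  have grad_sym: "grad_P \<T> P N i j = grad_P \<T> P N j i" for i j
    using P_sym by (intro grad_P_cong[OF T N(1)])

  let ?M = "\<lambda>k. A_on f \<T> P N k - \<mu>' k *\<^sub>R cpa \<T> P k"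
  let ?c1 = "h\<^sup>2 * (?n * ((1 + 2 * sqrt ?n) * B N * D N + 2 * ?n * B3 N * C N))"
  let ?c2 = "D\<^sub>\<mu> S * (sqrt ?n * h) * (D N * h)"
  have xN: "x \<in> N"
    using S(2) N(2) by blast
  have A_error: "\<bar>(\<Sum>k\<in>K. u k * A_on f \<T> P N k $ i $ j) - A_on f \<T> P N x $ i $ j\<bar> \<le> ?c1" for i j
    by (rule A_on_interpolation_error[OF T N \<open>C_k 3 f\<close> bounds(1,2) f1(3) P_bound[OF xN]])
  have \<mu>P_error: "\<bar>(\<Sum>k\<in>K. u k * (\<mu>' k * cpa \<T> P k $ i $ j))
      - cpa \<T>' \<mu>' x * cpa \<T> P x $ i $ j\<bar> \<le> ?c2" for i j
  proof -
    have KN: "k \<in> S" "k \<in> N" if "k \<in> K" for k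
      using that KS N(2) by auto
    have meanP: "(\<Sum>k\<in>K. u k * cpa \<T> P k $ i $ j) = cpa \<T> P x $ i $ j"
      by (rule mean_affine[where p = "\<lambda>y. cpa \<T> P y $ i $ j"]) (rule cpa_entry_diff_eq_grad_P[OF T N(1) xN KN(2)])
    \<comment> \<open>Both factors are interpolated exactly, so only their covariance remains.\<close>
    have "\<bar>(\<Sum>k\<in>K. u k * (cpa \<T>' \<mu>' k * cpa \<T> P k $ i $ j))
        - cpa \<T>' \<mu>' x * cpa \<T> P x $ i $ j\<bar> \<le> ?c2 + \<bar>cpa \<T>' \<mu>' x\<bar> * 0"
    proof (rule product_interpolation_error[where q = "\<lambda>y. cpa \<T> P y $ i $ j"])
      show "(\<Sum>k\<in>K. u k * cpa \<T>' \<mu>' k) = cpa \<T>' \<mu>' x"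
        by (simp add: \<mu>K \<mu>x)
      show "\<bar>(\<Sum>k\<in>K. u k * cpa \<T> P k $ i $ j) - cpa \<T> P x $ i $ j\<bar> \<le> 0"
        by (simp add: meanP)
    next
      fix k assume k: "k \<in> K"
      let ?g = "simplex_gradient S (cpa \<T>' \<mu>')"
      have "\<bar>cpa \<T>' \<mu>' k - cpa \<T>' \<mu>' x\<bar> = \<bar>(k - x) \<bullet> ?g\<bar>"
        by (simp add: cpa_diff_eq_gradient[OF T' S(1,2) KN(1)[OF k]] inner_commute)
      also have "\<dots> \<le> norm_1 (k - x) * infnorm ?g"
        by (rule norm_1_Holder)
      also have "\<dots> \<le> (sqrt ?n * h) * D\<^sub>\<mu> S"
      proof (rule mult_mono[OF _ f2(2)])
        show "norm_1 (k - x) \<le> sqrt ?n * h"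
          by (rule order_trans[OF norm_1_le_norm mult_left_mono[OF radius[OF k]]]) simp
        show "0 \<le> sqrt ?n * h"
          using order_trans[OF norm_ge_zero radius[OF k]] by simp
      qed (rule infnorm_pos_le)
      finally show "\<bar>cpa \<T>' \<mu>' k - cpa \<T>' \<mu>' x\<bar> \<le> D\<^sub>\<mu> S * (sqrt ?n * h)"
        by (simp only: mult_ac)
      show "\<bar>cpa \<T> P k $ i $ j - cpa \<T> P x $ i $ j\<bar> \<le> D N * h"
        unfolding cpa_entry_diff_eq_grad_P[OF T N(1) xN KN(2)[OF k]] by (rule abs_inner_le_norm_1[OF f1(3) radius[OF k]])
    qed simp
    then show ?thesis
      by (simp add: \<mu>K)
  qed
  have "A_on f \<T> P N x - cpa \<T>' \<mu>' x *\<^sub>R cpa \<T> P x \<preceq>\<^sub>L 0"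
  proof (rule loewner_nonpos_from_vertices[OF _ _ weight_sum A_vertex])
    have "f differentiable (at x)"
      using \<open>C_k 3 f\<close> by (simp add: numeral_eq_Suc)
    note entry = A_on_entry[OF this]
    have swap: "(\<Sum>l\<in>UNIV. cpa \<T> P x $ a $ l * q l) = (\<Sum>l\<in>UNIV. cpa \<T> P x $ l $ a * q l)" for a q
      by (intro sum.cong refl arg_cong2[where f = "(*)"] P_sym xN)
    show "symmetric_matrix (A_on f \<T> P N x - cpa \<T>' \<mu>' x *\<^sub>R cpa \<T> P x)"
      unfolding symmetric_matrix_iff
    proof (intro allI)
      fix i j
      have "A_on f \<T> P N x $ i $ j = A_on f \<T> P N x $ j $ i"
        unfolding entry grad_sym[of i j] swap[of i] swap[of j] by simp
      then show "(A_on f \<T> P N x - cpa \<T>' \<mu>' x *\<^sub>R cpa \<T> P x) $ i $ j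
          = (A_on f \<T> P N x - cpa \<T>' \<mu>' x *\<^sub>R cpa \<T> P x) $ j $ i"
        using P_sym[OF xN, of i j] by simp
    qed
    show "\<bar>(A_on f \<T> P N x - cpa \<T>' \<mu>' x *\<^sub>R cpa \<T> P x) $ i $ j
        - (\<Sum>k\<in>K. u k * ?M k $ i $ j)\<bar> \<le> ?c1 + ?c2" for i j
      using A_error[of i j] \<mu>P_error[of i j] by (simp add: right_diff_distrib sum_subtractf)
    \<comment> \<open>The slack: the margin has \<open>1 + 4 sqrt n\<close> and \<open>2 n sqrt n\<close> where the entrywise errors,
      multiplied by \<open>n\<close>, need only \<open>1 + 2 sqrt n\<close> and \<open>n sqrt n\<close>.\<close>
    have "0 \<le> h\<^sup>2 * (?n\<^sup>2 * (2 * sqrt ?n * B N * D N) + ?n * sqrt ?n * D N * D\<^sub>\<mu> S)"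
      using \<open>0 \<le> B N\<close> f1(2) f2(1) by simp
    then show "?n * (?c1 + ?c2) \<le> h\<^sup>2 * (E_const B B3 C D N + 2 * ?n * sqrt ?n * D N * D\<^sub>\<mu> S)"
      by (simp add: E_const_def Let_def algebra_simps power2_eq_square)
  qed (rule weight_nonneg)
  then have A: "A_at f \<T> \<T>' P x - cpa \<T>' \<mu>' x *\<^sub>R cpa \<T> P x \<preceq>\<^sub>L 0"
    by (simp add: A_at_def N_def S_def)

  let ?g = "simplex_gradient S (cpa \<T>' V)"
  have "?g \<bullet> f x + m * cpa \<T>' \<mu>' x
      \<le> (\<Sum>k\<in>K. u k * (?g \<bullet> f k)) + ?n * B' S * h\<^sup>2 * norm_1 ?g + m * cpa \<T>' \<mu>' x"
    using f_error[of ?g] by linarith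
  also have "\<dots> \<le> (\<Sum>k\<in>K. u k * (?g \<bullet> f k)) + ?n * B' S * h\<^sup>2 * D\<^sub>V S + m * cpa \<T>' \<mu>' x"
    using f2(3) \<open>0 \<le> B' S\<close> by (intro add_left_mono add_right_mono mult_left_mono) auto
  also have "\<dots> = (\<Sum>k\<in>K. u k * (?g \<bullet> f k + m * \<mu>' k)) + (\<Sum>k\<in>K. u k) * (h\<^sup>2 * ?n * B' S * D\<^sub>V S)"
    by (simp add: \<mu>x weight_sum distrib_left sum.distrib sum_distrib_left mult_ac)
  also have "\<dots> = (\<Sum>k\<in>K. u k * (?g \<bullet> f k + h\<^sup>2 * ?n * B' S * D\<^sub>V S + m * \<mu>' k))"
    unfolding sum_distrib_right sum.distrib[symmetric] by (intro sum.cong refl) (simp add: algebra_simps)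
  also have "\<dots> \<le> (\<Sum>k\<in>K. u k * Q)"
    by (intro sum_mono mult_left_mono V_vertex weight_nonneg)
  also have "\<dots> = Q"
    by (simp add: sum_distrib_right[symmetric] weight_sum)
  finally have "V_dot f \<T>' V x + m * cpa \<T>' \<mu>' x \<le> Q"
    by (simp add: V_dot_def S_def)
  with A show "A_at f \<T> \<T>' P x - cpa \<T>' \<mu>' x *\<^sub>R cpa \<T> P x \<preceq>\<^sub>L 0 \<and>
    V_dot f \<T>' V x + m * cpa \<T>' \<mu>' x \<le> Q" ..
qed

end
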